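(* Let $L(0,x)$ be the Dirac operator with linear potential on the whole axis. The eigenvalues of $L(0,x)$ are $$\lambda_n(0,x)=\operatorname{sign}(n)\sqrt{2|n|},\qquad n\in\mathbb{Z},$$ and the corresponding eigenfunctions are the vector-functions $U_n$, $n\in\mathbb{Z}$, given by $$U_0(x)=\begin{pmatrix}0\\ \varphi_0(x)\end{pmatrix},\qquad U_n(x)=\begin{pmatrix}\varphi_{n-1}(x)\\ \varphi_n(x)\end{pmatrix},\qquad U_{-n}(x)=\begin{pmatrix}-\varphi_{n-1}(x)\\ \varphi_n(x)\end{pmatrix},\qquad n=1,2,\ldots,$$ where $\varphi_n$ ($n=0,1,2,\ldots$) are the Chebyshev-Hermite orthonormal functions.
   Context: $L(0,x)$ is the self-adjoint operator in $L^2((-\infty,\infty);\mathbb{C}^2)$ generated by the differential expression $$\ell y=B\frac{dy}{dx}+\Omega_0(x)y,\qquad B=\begin{pmatrix}0&1\\ -1&0\end{pmatrix},\qquad \Omega_0(x)=\begin{pmatrix}0&x\\ x&0\end{pmatrix},\qquad y=\begin{pmatrix}y_1\\ y_2\end{pmatrix},$$ on the domain $D$ of all $y$ such that $y_k\in L^2(-\infty,\infty)$, $y_k$ is absolutely continuous on each finite segment $[a,b]\subset(-\infty,\infty)$, and $(\ell y)_k\in L^2(-\infty,\infty)$, $k=1,2$. The eigenvalues are the values $\lambda\in\mathbb{C}$ for which $\ell y=\lambda y$ has a nontrivial solution $y\in D$; the corresponding nontrivial solutions in $D$ are the eigenfunctions. Here $\operatorname{sign}(0)=0$. The Chebyshev-Hermite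 polynomials are $H_n(x)=(-1)^n e^{x^2}\dfrac{d^n e^{-x^2}}{dx^n}$, and the Chebyshev-Hermite orthonormal functions are $\varphi_n(x)=C_n e^{-x^2/2}H_n(x)$ with $C_n=\dfrac{1}{\sqrt{2^n n!\sqrt{\pi}}}$, $n=0,1,2,\ldots$. *)

theory Defs
  imports "HOL-Analysis.Analysis"
begin

definition square_integrable :: "(real \<Rightarrow> complex) \<Rightarrow> bool" where
  "square_integrable f \<longleftrightarrow>
     f \<in> borel_measurable lebesgue \<and> integrable lebesgue (\<lambda>x. (cmod (f x))\<^sup>2)"

text \<open>Here \<open>\<D> division_of \<Union>\<D>\<close> says that \<open>\<D>\<close> is an arbitrary finite family of
  nonempty, non-overlapping compact intervals; such an interval is \<open>{Inf K..Sup K}\<close>.\<close>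

definition absolutely_continuous_on :: "real set \<Rightarrow> (real \<Rightarrow> 'a::real_normed_vector) \<Rightarrow> bool" where
  "absolutely_continuous_on S f \<longleftrightarrow>
     (\<forall>\<epsilon>>0. \<exists>\<delta>>0. \<forall>\<D>. \<D> division_of \<Union>\<D> \<and> \<Union>\<D> \<subseteq> S \<and> (\<Sum>K\<in>\<D>. Sup K - Inf K) < \<delta>
        \<longrightarrow> (\<Sum>K\<in>\<D>. norm (f (Sup K) - f (Inf K))) < \<epsilon>)"

definition B_mat :: "complex^2^2" where
  "B_mat = vector [vector [0, 1], vector [-1, 0]]"

definition Omega0 :: "real \<Rightarrow> complex^2^2" where
  "Omega0 x = vector [vector [0, of_real x], vector [of_real x, 0]]"

text \<open>Where \<open>y\<close> is not differentiable, \<open>vector_derivative\<close> has an unspecified value. For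
  locally absolutely continuous \<open>y\<close> this concerns only a null set, which neither membership in
  the (Lebesgue) \<open>L\<^sup>2\<close> space nor an equation holding almost everywhere can see.\<close>

definition dirac_expr :: "(real \<Rightarrow> complex^2) \<Rightarrow> real \<Rightarrow> complex^2" where
  "dirac_expr y x = B_mat *v vector_derivative y (at x) + Omega0 x *v y x"

definition dirac_domain :: "(real \<Rightarrow> complex^2) set" where
  "dirac_domain = {y. \<forall>k. square_integrable (\<lambda>x. y x $ k)
      \<and> (\<forall>a b. absolutely_continuous_on {a..b} (\<lambda>x. y x $ k))
      \<and> square_integrable (\<lambda>x. dirac_expr y x $ k)}"

text \<open>Elements of the domain are continuous, so vanishing almost everywhere and vanishing
  everywhere coincide for them.\<close>

definition dirac_eigenfunction :: "complex \<Rightarrow> (real \<Rightarrow> complex^2) \<Rightarrow> bool" where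
  "dirac_eigenfunction \<mu> y \<longleftrightarrow>
     y \<in> dirac_domain \<and> y \<noteq> (\<lambda>x. 0) \<and> (AE x in lebesgue. dirac_expr y x = \<mu> *s y x)"

definition dirac_eigenvalue :: "complex \<Rightarrow> bool" where
  "dirac_eigenvalue \<mu> \<longleftrightarrow> (\<exists>y. dirac_eigenfunction \<mu> y)"

definition hermite_H :: "nat \<Rightarrow> real \<Rightarrow> real" where
  "hermite_H n x = (-1) ^ n * exp (x\<^sup>2) * (deriv ^^ n) (\<lambda>t. exp (- t\<^sup>2)) x"

definition hermite_C :: "nat \<Rightarrow> real" where
  "hermite_C n = 1 / sqrt (2 ^ n * fact n * sqrt pi)"

definition hermite_phi :: "nat \<Rightarrow> real \<Rightarrow> real" where
  "hermite_phi n x = hermite_C n * exp (- x\<^sup>2 / 2) * hermite_H n x"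

definition dirac_lambda :: "int \<Rightarrow> real" where
  "dirac_lambda n = of_int (sgn n) * sqrt (2 * of_int \<bar>n\<bar>)"

definition dirac_U :: "int \<Rightarrow> real \<Rightarrow> complex^2" where
  "dirac_U n x =
     (if n = 0 then vector [0, of_real (hermite_phi 0 x)]
      else if n > 0 then
        vector [of_real (hermite_phi (nat n - 1) x), of_real (hermite_phi (nat n) x)]
      else
        vector [- of_real (hermite_phi (nat (- n) - 1) x), of_real (hermite_phi (nat (- n)) x)])"

end

theory Submission
  imports Defs "HOL-Probability.Distributions"
begin

text \<open>With \<open>A = d/dx + x\<close> and \<open>A* = - d/dx + x\<close>, the eigenvalue equation for \<open>y = (y\<^sub>1, y\<^sub>2)\<close> reads
  \<open>A y\<^sub>2 = \<mu> y\<^sub>1\<close>, \<open>A* y\<^sub>1 = \<mu> y\<^sub>2\<close>, so \<open>f = y\<^sub>2\<close> satisfies \<open>A* A f = \<nu> f\<close> with \<open>\<nu> = \<mu>\<^sup>2\<close>. Square integrability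
  gives \<open>\<parallel>A f\<parallel>\<^sup>2 = \<nu> \<parallel>f\<parallel>\<^sup>2\<close>, hence \<open>\<nu> \<ge> 0\<close>, and \<open>A f\<close> is again a square integrable solution, for \<open>\<nu> - 2\<close>.
  As \<open>\<nu>\<close> cannot become negative, some \<open>A\<^sup>n\<^sup>+\<^sup>1 f\<close> vanishes; then \<open>\<nu> = 2 n\<close>, \<open>A\<^sup>n f\<close> is a Gaussian, and
  climbing back with \<open>A*\<close> identifies \<open>f\<close> as a multiple of the \<open>n\<close>-th Hermite function.

  An absolutely continuous solution of the equation almost everywhere is a classical solution by a
  mean value inequality, obtained by applying absolute continuity to a fine tagged division.\<close>

section \<open>Absolutely continuous functions\<close>

text \<open>The equation is read with \<open>vector_derivative\<close>, which returns one arbitrary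
  fixed vector wherever \<open>y\<close> is not differentiable. There the equation is a purely
  algebraic relation, and before the mean value inequality can be used, such points must be shown to
  form a null set. This is extracted from the equation itself, by a density point argument on the
  closed set where the relation holds. Square integrability is used only as boundedness of a
  primitive of the squared modulus. Integration by parts then becomes differentiation of a product,
  and the boundary terms need to be small only along some T tending to infinity. The shift from
  \<nu> to \<nu> - 2 is the commutator identity \<open>A A* - A* A = 2\<close>. The value \<mu> = 0
  stands apart: there the second component carries no information about the first, which is excluded
  as a growing Gaussian.\<close>

lemma absolutely_continuous_onD_division:
  assumes "absolutely_continuous_on S f" "\<epsilon> > 0"
  obtains \<delta> where "\<delta> > 0"
    "\<And>\<D>. \<D> division_of \<Union>\<D> \<Longrightarrow> \<Union>\<D> \<subseteq> S \<Longrightarrow> (\<Sum>K\<in>\<D>. Sup K - Inf K) < \<delta>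
      \<Longrightarrow> (\<Sum>K\<in>\<D>. norm (f (Sup K) - f (Inf K))) < \<epsilon>"
proof -
  obtain \<delta> where "\<delta> > 0" and "\<forall>\<D>. \<D> division_of \<Union>\<D> \<and> \<Union>\<D> \<subseteq> S \<and> (\<Sum>K\<in>\<D>. Sup K - Inf K) < \<delta>
        \<longrightarrow> (\<Sum>K\<in>\<D>. norm (f (Sup K) - f (Inf K))) < \<epsilon>"
    using assms(1)[unfolded absolutely_continuous_on_def, rule_format, OF assms(2)] by (elim exE conjE)
  then show thesis
    by (intro that[of \<delta>]) auto
qed

lemma absolutely_continuous_on_imp_continuous_on:
  assumes "absolutely_continuous_on {a..b} f"
  shows "continuous_on {a..b} f"
proof (rule continuous_onI)
  fix x \<epsilon> :: real
  assume x: "x \<in> {a..b}" and "\<epsilon> > 0"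
  from assms this(2) obtain \<delta> where \<delta>: "\<delta> > 0"
    "\<And>\<D>. \<D> division_of \<Union>\<D> \<Longrightarrow> \<Union>\<D> \<subseteq> {a..b} \<Longrightarrow> (\<Sum>K\<in>\<D>. Sup K - Inf K) < \<delta>
      \<Longrightarrow> (\<Sum>K\<in>\<D>. norm (f (Sup K) - f (Inf K))) < \<epsilon>"
    by (rule absolutely_continuous_onD_division) blast
  have "dist (f x') (f x) \<le> \<epsilon>" if x': "x' \<in> {a..b}" and d: "dist x' x < \<delta>" for x'
  proof -
    let ?l = "min x x'" and ?r = "max x x'"
    have "{{?l..?r}} division_of {?l..?r}"
      using division_of_self[of ?l ?r] by (simp add: cbox_interval)
    then have "norm (f ?r - f ?l) < \<epsilon>"
      using \<delta>(2)[of "{{?l..?r}}"] x x' d by (auto simp: dist_real_def)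
    then show ?thesis
      by (cases "x \<le> x'") (auto simp: dist_norm norm_minus_commute)
  qed
  with \<delta>(1) show "\<exists>d>0. \<forall>x'\<in>{a..b}. dist x' x < d \<longrightarrow> dist (f x') (f x) \<le> \<epsilon>"
    by blast
qed

lemma absolutely_continuous_on_lipschitz:
  assumes lip: "\<And>x y. x \<in> S \<Longrightarrow> y \<in> S \<Longrightarrow> norm (f y - f x) \<le> L * \<bar>y - x\<bar>"
  shows "absolutely_continuous_on S f"
  unfolding absolutely_continuous_on_def
proof (intro allI impI)
  fix \<epsilon> :: real assume "\<epsilon> > 0"
  \<comment> \<open>\<open>L\<close> may be zero or negative, so \<open>\<bar>L\<bar> + 1\<close>
    serves as a positive Lipschitz constant.\<close>
  define \<delta> where "\<delta> = \<epsilon> / (\<bar>L\<bar> + 1)"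
  have "\<delta> > 0"
    using \<open>\<epsilon> > 0\<close> by (auto simp: \<delta>_def)
  moreover have "(\<Sum>K\<in>\<D>. norm (f (Sup K) - f (Inf K))) < \<epsilon>"
    if D: "\<D> division_of \<Union>\<D>" "\<Union>\<D> \<subseteq> S" "(\<Sum>K\<in>\<D>. Sup K - Inf K) < \<delta>" for \<D>
  proof -
    have "norm (f (Sup K) - f (Inf K)) \<le> (\<bar>L\<bar> + 1) * (Sup K - Inf K)" if "K \<in> \<D>" for K
    proof -
      obtain c d where K: "K = cbox c d" "K \<noteq> {}"
        using D(1) \<open>K \<in> \<D>\<close> by (metis division_ofD(3,4))
      then have cd: "c \<le> d" by simp
      have "norm (f d - f c) \<le> L * \<bar>d - c\<bar>"
        using lip[of c d] D(2) \<open>K \<in> \<D>\<close> K cd by (metis Union_upper box_real(2) atLeastAtMost_iff order_refl subsetD)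
      also have "\<dots> \<le> (\<bar>L\<bar> + 1) * (d - c)"
        using cd by (simp add: mult_right_mono)
      finally show ?thesis using K cd by simp
    qed
    then have "(\<Sum>K\<in>\<D>. norm (f (Sup K) - f (Inf K))) \<le> (\<Sum>K\<in>\<D>. (\<bar>L\<bar> + 1) * (Sup K - Inf K))"
      by (rule sum_mono)
    also have "\<dots> = (\<bar>L\<bar> + 1) * (\<Sum>K\<in>\<D>. Sup K - Inf K)"
      by (simp add: sum_distrib_left)
    also have "\<dots> < (\<bar>L\<bar> + 1) * \<delta>"
      using D(3) by (intro mult_strict_left_mono) auto
    also have "\<dots> = \<epsilon>" by (simp add: \<delta>_def)
    finally show ?thesis .
  qed
  ultimately show "\<exists>\<delta>>0. \<forall>\<D>. \<D> division_of \<Union>\<D> \<and> \<Union>\<D> \<subseteq> S \<and> (\<Sum>K\<in>\<D>. Sup K - Inf K) < \<delta>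
        \<longrightarrow> (\<Sum>K\<in>\<D>. norm (f (Sup K) - f (Inf K))) < \<epsilon>"
    by blast
qed

lemma absolutely_continuous_on_C1:
  assumes "\<And>x. (f has_vector_derivative f' x) (at x)" and "continuous_on UNIV f'"
  shows "absolutely_continuous_on {a..b} f"
proof -
  have "bounded (f' ` {a..b})"
    using assms(2) by (meson compact_Icc compact_continuous_image compact_imp_bounded
        continuous_on_subset subset_UNIV)
  then obtain L where L: "\<And>x. x \<in> {a..b} \<Longrightarrow> norm (f' x) \<le> L"
    unfolding bounded_iff by blast
  show ?thesis
  proof (rule absolutely_continuous_on_lipschitz)
    fix x y assume xy: "x \<in> {a..b}" "y \<in> {a..b}"
    have "norm (f y - f x) \<le> L * norm (y - x)"
    proof (rule differentiable_bound[OF convex_real_interval(5)[of a b] _ _ xy(2,1)])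
      fix z assume z: "z \<in> {a..b}"
      show "(f has_derivative (\<lambda>h. h *\<^sub>R f' z)) (at z within {a..b})"
        using assms(1) has_derivative_at_withinI unfolding has_vector_derivative_def by blast
      show "onorm (\<lambda>h. h *\<^sub>R f' z) \<le> L"
        using L[OF z] by (intro onorm_le) (simp add: mult.commute[of L] mult_left_mono)
    qed
    then show "norm (f y - f x) \<le> L * \<bar>y - x\<bar>" by simp
  qed
qed

section \<open>Mean value inequality from a derivative bound almost everywhere\<close>

lemma negligible_of_AE:
  assumes "AE x in lebesgue. P x"
  shows "negligible {x. \<not> P x}"
proof -
  obtain N where "N \<in> null_sets lebesgue" "{x \<in> space lebesgue. \<not> P x} \<subseteq> N"
    using assms unfolding eventually_ae_filter by blast
  then show ?thesis
    using negligible_iff_null_sets negligible_subset by auto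
qed

text \<open>Cells of a fine tagged division are of two kinds. If the tag lies outside a null set,
  differentiability controls the increment of the cell. Cells with tags in the null set stay inside
  an open set of tiny measure, where absolute continuity bounds the sum of all increments at once.
  The reference slope \<open>c\<close> is free: zero yields Lipschitz bounds, a presumed derivative
  yields differentiability.\<close>

lemma absolutely_continuous_mean_value:
  fixes f :: "real \<Rightarrow> 'a::real_normed_vector"
  assumes ac: "absolutely_continuous_on {a..b} f" and "a \<le> b" and "K \<ge> 0"
    and ae: "AE x in lebesgue. x \<in> {a<..<b} \<longrightarrow>
      (\<exists>d. (f has_vector_derivative d) (at x) \<and> norm (d - c) \<le> K)"
  shows "norm (f b - f a - (b - a) *\<^sub>R c) \<le> K * (b - a)"
proof -
  \<comment> \<open>The hypothesis concerns the open interval only; counting the endpoints as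
    exceptional costs a null set.\<close>
  define N where "N = {a, b} \<union> {x. \<not> (x \<in> {a<..<b} \<longrightarrow>
      (\<exists>d. (f has_vector_derivative d) (at x) \<and> norm (d - c) \<le> K))}"
  have "negligible {x. \<not> (x \<in> {a<..<b} \<longrightarrow>
      (\<exists>d. (f has_vector_derivative d) (at x) \<and> norm (d - c) \<le> K))}"
    using ae by (rule negligible_of_AE)
  then have negN: "negligible N"
    unfolding N_def by (intro negligible_Un) auto
  \<comment> \<open>The error collects \<epsilon> times \<open>b - a\<close> from the good cells,
    \<epsilon> from the increments over the bad cells, and \<epsilon> times \<open>norm c\<close>
    from their total length.\<close>
  have "norm (f b - f a - (b - a) *\<^sub>R c) \<le> K * (b - a) + \<epsilon> * (b - a + 1 + norm c)" if "\<epsilon> > 0" for \<epsilon>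
  proof -
    obtain \<delta>0 where \<delta>0: "\<delta>0 > 0"
      "\<And>\<D>. \<D> division_of \<Union>\<D> \<Longrightarrow> \<Union>\<D> \<subseteq> {a..b} \<Longrightarrow> (\<Sum>K\<in>\<D>. Sup K - Inf K) < \<delta>0
      \<Longrightarrow> (\<Sum>K\<in>\<D>. norm (f (Sup K) - f (Inf K))) < \<epsilon>"
      using ac \<open>\<epsilon> > 0\<close> by (rule absolutely_continuous_onD_division) blast
    define \<delta> where "\<delta> = min \<delta>0 \<epsilon>"
    have "\<delta> > 0" using \<delta>0 \<open>\<epsilon> > 0\<close> by (simp add: \<delta>_def)
    obtain U where U: "open U" "N \<subseteq> U" "U \<in> lmeasurable" "measure lebesgue U < \<delta>"
    proof -
      obtain T where T: "open T" "N \<subseteq> T" "T - N \<in> lmeasurable"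
         "emeasure lebesgue (T - N) < ennreal \<delta>"
        using sets_lebesgue_outer_open[OF negligible_imp_sets[OF negN] \<open>\<delta> > 0\<close>] .
      have T': "T = (T - N) \<union> N" using T by auto
      have N: "N \<in> lmeasurable" using negN by (rule negligible_imp_measurable)
      have "measure lebesgue T \<le> measure lebesgue (T - N) + measure lebesgue N"
        using T(3) N T' by (metis measure_Un_le fmeasurableD)
      also have "\<dots> = measure lebesgue (T - N)"
        using negN by (simp add: negligible_imp_measure0)
      also have "\<dots> < \<delta>"
        using T(3,4) \<open>\<delta> > 0\<close> by (simp add: emeasure_eq_measure2 ennreal_less_iff)
      finally have "measure lebesgue T < \<delta>" .
      moreover have "T \<in> lmeasurable"
        using T(3) N T' by (metis fmeasurable.Un)
      ultimately show ?thesis using that T by blast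
    qed
    have "\<exists>r>0. \<forall>v. \<bar>v - x\<bar> < r \<longrightarrow> norm (f v - f x - (v - x) *\<^sub>R c) \<le> (K + \<epsilon>) * \<bar>v - x\<bar>"
      if x: "x \<in> {a..b}" "x \<notin> N" for x
    proof -
      from x obtain d where d: "(f has_vector_derivative d) (at x)" "norm (d - c) \<le> K"
        by (auto simp: N_def)
      then obtain r where r: "r > 0"
        "\<And>v. \<bar>v - x\<bar> < r \<Longrightarrow> norm (f v - f x - (v - x) *\<^sub>R d) \<le> \<epsilon> * \<bar>v - x\<bar>"
        using \<open>\<epsilon> > 0\<close> unfolding has_vector_derivative_def has_derivative_at_alt
        by (metis real_norm_def)
      have "norm (f v - f x - (v - x) *\<^sub>R c) \<le> (K + \<epsilon>) * \<bar>v - x\<bar>" if v: "\<bar>v - x\<bar> < r" for v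
      proof -
        have "f v - f x - (v - x) *\<^sub>R c = (f v - f x - (v - x) *\<^sub>R d) + (v - x) *\<^sub>R (d - c)"
          by (simp add: algebra_simps)
        also have "norm \<dots> \<le> \<epsilon> * \<bar>v - x\<bar> + \<bar>v - x\<bar> * K"
          using r(2)[OF v] d(2) by (intro norm_triangle_mono) (auto intro: mult_left_mono)
        finally show ?thesis by (simp add: algebra_simps)
      qed
      then show ?thesis using r(1) by blast
    qed
    then obtain r where r: "\<And>x. x \<in> {a..b} \<Longrightarrow> x \<notin> N \<Longrightarrow> r x > 0"
      "\<And>x v. x \<in> {a..b} \<Longrightarrow> x \<notin> N \<Longrightarrow> \<bar>v - x\<bar> < r x \<Longrightarrow>
         norm (f v - f x - (v - x) *\<^sub>R c) \<le> (K + \<epsilon>) * \<bar>v - x\<bar>"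
      by metis
    \<comment> \<open>A tag in \<open>N\<close> confines its cell to \<open>U\<close>, a good tag to
      the ball of its difference estimate. The last branch only makes the gauge total, since no tag
      lies outside \<open>{a..b}\<close>.\<close>
    define \<gamma> where "\<gamma> x = (if x \<in> N then U else if x \<in> {a..b} then ball x (r x) else ball x 1)" for x
    have "gauge \<gamma>"
      using U r(1) by (auto simp: gauge_def \<gamma>_def)
    then obtain p where p: "p tagged_division_of {a..b}" "\<gamma> fine p"
      using fine_division_exists_real by blast
    have finp: "finite p" using p(1) by blast
    define q where "q = {t \<in> p. fst t \<in> N}"
    have "q \<subseteq> p" by (auto simp: q_def)
    define e where "e I = f (Sup I) - f (Inf I) - (Sup I - Inf I) *\<^sub>R c" for I :: "real set"
    have cell: "\<exists>u v. I = {u..v} \<and> u \<le> v \<and> x \<in> {u..v} \<and> {u..v} \<subseteq> {a..b}" if xI: "(x, I) \<in> p" for x I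
    proof -
      obtain u v where "I = cbox u v" using tagged_division_ofD(4)[OF p(1) xI] by blast
      moreover have "x \<in> I" "I \<subseteq> {a..b}" using tagged_division_ofD(2,3)[OF p(1) xI] by auto
      ultimately show ?thesis by auto
    qed
    have good: "norm (e I) \<le> (K + \<epsilon>) * (Sup I - Inf I)" if xI: "(x, I) \<in> p - q" for x I
    proof -
      obtain u v where uv: "I = {u..v}" "u \<le> v" "u \<le> x" "x \<le> v" "{u..v} \<subseteq> {a..b}"
        using cell[of x I] xI by (metis DiffD1 atLeastAtMost_iff)
      have x: "x \<in> {a..b}" "x \<notin> N" using uv that by (auto simp: q_def)
      have "I \<subseteq> ball x (r x)"
        using fineD[OF p(2), of x I] xI x by (auto simp: \<gamma>_def)
      moreover have "u \<in> I" "v \<in> I" using uv by auto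
      ultimately have uvr: "\<bar>u - x\<bar> < r x" "\<bar>v - x\<bar> < r x"
        by (auto simp: subset_iff dist_real_def abs_minus_commute)
      \<comment> \<open>The cell is split at its tag; as \<open>x\<close> lies between
        \<open>u\<close> and \<open>v\<close>, the two distances add up to the length of the
        cell.\<close>
      have "e I = (f v - f x - (v - x) *\<^sub>R c) - (f u - f x - (u - x) *\<^sub>R c)"
        using uv by (simp add: e_def algebra_simps)
      also have "norm \<dots> \<le> (K + \<epsilon>) * \<bar>v - x\<bar> + (K + \<epsilon>) * \<bar>u - x\<bar>"
        using r(2)[OF x uvr(1)] r(2)[OF x uvr(2)] norm_triangle_ineq4 by (smt (verit))
      also have "\<dots> = (K + \<epsilon>) * (v - u)"
        using uv by (simp add: algebra_simps)
      finally show ?thesis using uv by simp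
    qed
    have qpart: "q tagged_partial_division_of {a..b}"
    proof (rule tagged_partial_division_subset[OF _ \<open>q \<subseteq> p\<close>])
      show "p tagged_partial_division_of {a..b}"
        using p(1) by (simp add: tagged_division_of_def)
    qed
    define \<D> where "\<D> = snd ` q"
    have qtag: "q tagged_division_of \<Union>\<D>"
      unfolding \<D>_def using qpart by (rule tagged_partial_division_of_Union_self)
    have D: "\<D> division_of \<Union>\<D>"
      unfolding \<D>_def using qpart by (rule partial_division_of_tagged_division)
    have Dcell: "\<exists>u v. I = {u..v} \<and> u \<le> v \<and> {u..v} \<subseteq> {a..b}" if "I \<in> \<D>" for I
    proof -
      obtain x where "(x, I) \<in> p" using \<open>I \<in> \<D>\<close> by (auto simp: \<D>_def q_def)
      from cell[OF this] show ?thesis by blast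
    qed
    then have Dab: "\<Union>\<D> \<subseteq> {a..b}"
      by blast
    have DU: "\<Union>\<D> \<subseteq> U"
    proof (rule Union_least)
      fix I assume "I \<in> \<D>"
      then obtain x where "(x, I) \<in> p" "x \<in> N" by (auto simp: \<D>_def q_def)
      then show "I \<subseteq> U" using fineD[OF p(2), of x I] by (simp add: \<gamma>_def)
    qed
    \<comment> \<open>Two pairs can share an interval only if it is a single point;
      \<open>h t t = 0\<close> makes such intervals harmless when pairs are replaced by
      intervals.\<close>
    have sumq: "(\<Sum>(x, I)\<in>q. h (Sup I) (Inf I)) = (\<Sum>I\<in>\<D>. h (Sup I) (Inf I))"
      if "\<And>t. h t t = 0" for h :: "real \<Rightarrow> real \<Rightarrow> real"
    proof -
      have "(\<Sum>(x, I)\<in>q. if I = {} then 0 else h (Sup I) (Inf I)) =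
          (\<Sum>I\<in>\<D>. if I = {} then 0 else h (Sup I) (Inf I))"
        unfolding \<D>_def
        by (rule sum.over_tagged_division_lemma[OF qtag]) (use that in \<open>auto simp: box_eq_empty\<close>)
      also have "(\<Sum>(x, I)\<in>q. if I = {} then 0 else h (Sup I) (Inf I)) = (\<Sum>(x, I)\<in>q. h (Sup I) (Inf I))"
      proof (rule sum.cong[OF refl], clarify)
        fix x I assume "(x, I) \<in> q"
        then have "I \<noteq> {}" using cell[of x I] \<open>q \<subseteq> p\<close> by auto
        then show "(if I = {} then 0 else h (Sup I) (Inf I)) = h (Sup I) (Inf I)" by simp
      qed
      also have "(\<Sum>I\<in>\<D>. if I = {} then 0 else h (Sup I) (Inf I)) = (\<Sum>I\<in>\<D>. h (Sup I) (Inf I))"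
        using D by (intro sum.cong) (auto dest: division_ofD(3))
      finally show ?thesis .
    qed
    have "(\<Sum>I\<in>\<D>. Sup I - Inf I) = (\<Sum>I\<in>\<D>. measure lebesgue I)"
    proof (rule sum.cong[OF refl])
      fix I assume "I \<in> \<D>"
      then obtain u v where "I = {u..v}" "u \<le> v"
        using Dcell by blast
      then show "Sup I - Inf I = measure lebesgue I" by simp
    qed
    also have "\<dots> = measure lebesgue (\<Union>\<D>)"
      using content_division[OF D] .
    also have "\<dots> \<le> measure lebesgue U"
      using DU U(3) lmeasurable_division[OF D]
      by (intro measure_mono_fmeasurable) (auto intro: fmeasurableD)
    finally have len: "(\<Sum>I\<in>\<D>. Sup I - Inf I) < \<delta>"
      using U(4) by simp
    have small: "(\<Sum>I\<in>\<D>. norm (f (Sup I) - f (Inf I))) < \<epsilon>"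
      using \<delta>0(2)[OF D Dab] len by (simp add: \<delta>_def)
    have total: "(\<Sum>(x, I)\<in>p. Sup I - Inf I) = b - a"
      using additive_tagged_division_1[OF \<open>a \<le> b\<close> p(1), of "\<lambda>x. x"] by simp
    have "f b - f a - (b - a) *\<^sub>R c = (\<Sum>(x, I)\<in>p. e I)"
      using additive_tagged_division_1[OF \<open>a \<le> b\<close> p(1), of "\<lambda>x. f x - x *\<^sub>R c"]
      by (simp add: e_def algebra_simps)
    also have "norm \<dots> \<le> (\<Sum>(x, I)\<in>p. norm (e I))"
      using norm_sum[of "\<lambda>(x, I). e I" p] by (simp add: case_prod_unfold)
    also have "\<dots> = (\<Sum>(x, I)\<in>p - q. norm (e I)) + (\<Sum>(x, I)\<in>q. norm (e I))"
      using finp \<open>q \<subseteq> p\<close> by (simp add: sum.subset_diff)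
    also have "(\<Sum>(x, I)\<in>p - q. norm (e I)) \<le> (\<Sum>(x, I)\<in>p - q. (K + \<epsilon>) * (Sup I - Inf I))"
      using good by (intro sum_mono) auto
    also have "\<dots> \<le> (\<Sum>(x, I)\<in>p. (K + \<epsilon>) * (Sup I - Inf I))"
    proof (rule sum_mono2[OF finp])
      fix t assume "t \<in> p - (p - q)"
      then obtain x u v where "t = (x, {u..v})" "u \<le> v"
        using cell by (metis DiffD1 surj_pair)
      then show "0 \<le> (case t of (x, I) \<Rightarrow> (K + \<epsilon>) * (Sup I - Inf I))"
        using \<open>K \<ge> 0\<close> \<open>\<epsilon> > 0\<close> by simp
    qed auto
    also have "\<dots> = (K + \<epsilon>) * (b - a)"
      using total by (simp add: case_prod_unfold flip: sum_distrib_left)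
    also have "(\<Sum>(x, I)\<in>q. norm (e I)) \<le>
        (\<Sum>(x, I)\<in>q. norm (f (Sup I) - f (Inf I)) + \<bar>Sup I - Inf I\<bar> * norm c)"
      unfolding e_def by (intro sum_mono) (auto intro!: order_trans[OF norm_triangle_ineq4])
    also have "\<dots> = (\<Sum>I\<in>\<D>. norm (f (Sup I) - f (Inf I)) + \<bar>Sup I - Inf I\<bar> * norm c)"
      by (rule sumq) simp
    also have "\<dots> = (\<Sum>I\<in>\<D>. norm (f (Sup I) - f (Inf I))) + (\<Sum>I\<in>\<D>. \<bar>Sup I - Inf I\<bar>) * norm c"
      by (simp add: sum.distrib sum_distrib_right)
    also have "(\<Sum>I\<in>\<D>. \<bar>Sup I - Inf I\<bar>) = (\<Sum>I\<in>\<D>. Sup I - Inf I)"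
    proof (rule sum.cong[OF refl])
      fix I assume "I \<in> \<D>"
      then obtain u v where "I = {u..v}" "u \<le> v"
        using Dcell by blast
      then show "\<bar>Sup I - Inf I\<bar> = Sup I - Inf I" by simp
    qed
    also have "(\<Sum>I\<in>\<D>. norm (f (Sup I) - f (Inf I))) + (\<Sum>I\<in>\<D>. Sup I - Inf I) * norm c \<le> \<epsilon> + \<epsilon> * norm c"
      using small len by (intro add_mono mult_right_mono) (auto simp: \<delta>_def)
    finally show ?thesis by (simp add: algebra_simps)
  qed
  note * = this
  show ?thesis
  proof (rule field_le_epsilon)
    fix e :: real assume "e > 0"
    have pos: "b - a + 1 + norm c > 0" using \<open>a \<le> b\<close> by (smt (verit) norm_ge_zero)
    with *[of "e / (b - a + 1 + norm c)"] \<open>e > 0\<close>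
    show "norm (f b - f a - (b - a) *\<^sub>R c) \<le> K * (b - a) + e" by simp
  qed
qed

text \<open>Near \<open>x\<close> the continuous \<open>g\<close> is within \<epsilon> of
  \<open>g x\<close>. The mean value inequality with slope \<open>g x\<close> and bound \<epsilon>
  is then exactly the difference estimate at \<open>x\<close>, with no exceptional point
  left.\<close>

lemma has_vector_derivative_of_AE:
  fixes f g :: "real \<Rightarrow> 'a::real_normed_vector"
  assumes ac: "\<And>a b. absolutely_continuous_on {a..b} f"
    and cont: "continuous_on UNIV g"
    and ae: "AE x in lebesgue. (f has_vector_derivative g x) (at x)"
  shows "(f has_vector_derivative g x) (at x)"
  unfolding has_vector_derivative_def has_derivative_at_alt
proof (intro conjI allI impI)
  show "bounded_linear (\<lambda>h. h *\<^sub>R g x)" by (rule bounded_linear_scaleR_left)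
  fix \<epsilon> :: real assume "\<epsilon> > 0"
  have "isCont g x" using cont by (simp add: continuous_on_eq_continuous_at)
  then obtain r where r: "r > 0" "\<And>y. \<bar>y - x\<bar> < r \<Longrightarrow> norm (g y - g x) < \<epsilon>"
    using \<open>\<epsilon> > 0\<close> unfolding continuous_at_eps_delta dist_norm by (metis real_norm_def)
  have *: "norm (f b - f a - (b - a) *\<^sub>R g x) \<le> \<epsilon> * (b - a)"
    if "a \<le> b" "\<And>y. y \<in> {a<..<b} \<Longrightarrow> \<bar>y - x\<bar> < r" for a b
  proof (rule absolutely_continuous_mean_value[OF ac \<open>a \<le> b\<close>])
    show "AE y in lebesgue. y \<in> {a<..<b} \<longrightarrow>
        (\<exists>d. (f has_vector_derivative d) (at y) \<and> norm (d - g x) \<le> \<epsilon>)"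
      using ae by eventually_elim (use that(2) r(2) in \<open>force intro: less_imp_le\<close>)
  qed (use \<open>\<epsilon> > 0\<close> in simp)
  have "norm (f y - f x - (y - x) *\<^sub>R g x) \<le> \<epsilon> * norm (y - x)" if y: "norm (y - x) < r" for y
  proof (cases "x \<le> y")
    case True
    then show ?thesis using *[of x y] y by auto
  next
    case False
    have "f y - f x - (y - x) *\<^sub>R g x = - (f x - f y - (x - y) *\<^sub>R g x)"
      by (simp add: algebra_simps)
    then have "norm (f y - f x - (y - x) *\<^sub>R g x) = norm (f x - f y - (x - y) *\<^sub>R g x)"
      by (metis norm_minus_cancel)
    then show ?thesis using *[of y x] y False by auto
  qed
  then show "\<exists>d>0. \<forall>y. norm (y - x) < d \<longrightarrow> norm (f y - f x - (y - x) *\<^sub>R g x) \<le> \<epsilon> * norm (y - x)"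
    using r(1) by blast
qed

section \<open>Regularity of eigenfunctions\<close>

lemma continuous_on_UNIV_if_absolutely_continuous:
  fixes f :: "real \<Rightarrow> 'a::real_normed_vector"
  assumes "\<And>a b. absolutely_continuous_on {a..b} f"
  shows "continuous_on UNIV f"
proof (rule continuous_at_imp_continuous_on, rule ballI)
  fix x :: real
  have "continuous_on {x-1<..<x+1} f"
    using absolutely_continuous_on_imp_continuous_on[OF assms, of "x-1" "x+1"]
    by (rule continuous_on_subset) auto
  then show "isCont f x" by (simp add: continuous_on_eq_continuous_at)
qed

section \<open>Density points of closed sets\<close>

lemma AE_of_negligible:
  assumes "negligible N" "\<And>x. x \<notin> N \<Longrightarrow> P x"
  shows "AE x in lebesgue. P x"
  using assms by (intro AE_I'[of N]) (auto simp: negligible_iff_null_sets)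

text \<open>Lebesgue differentiation of the indicator of the complement: for almost every
  \<open>p\<close> in \<open>Z\<close>, the complement fills a vanishing proportion of short
  segments starting at \<open>p\<close>, and a gap lies inside the complement.\<close>

lemma closed_gaps_small_right:
  fixes Z :: "real set"
  assumes "closed Z"
  shows "AE p in lebesgue. p \<in> Z \<longrightarrow> (\<forall>\<epsilon>>0. \<exists>d>0. \<forall>z x. p \<le> z \<and> z < x \<and> x < p + d \<and>
           {z<..x} \<inter> Z = {} \<longrightarrow> x - z \<le> \<epsilon> * (x - p))"
proof -
  define g :: "real \<Rightarrow> real" where "g = indicat_real (- Z)"
  have intg: "g integrable_on cbox a b" for a b
  proof -
    have "- Z \<inter> cbox a b \<in> lmeasurable"
      using assms by (intro bounded_set_imp_lmeasurable) (auto intro!: bounded_Int sets.Int simp: open_Compl)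
    then have "(\<lambda>x. 1::real) integrable_on (- Z \<inter> cbox a b)"
      by (simp add: integrable_on_const)
    then have "(\<lambda>x. if x \<in> - Z \<inter> cbox a b then 1 else 0 :: real) integrable_on UNIV"
      by (subst integrable_restrict_UNIV)
    then have "(\<lambda>x. if x \<in> cbox a b then g x else 0) integrable_on UNIV"
      by (rule integrable_eq) (auto simp: g_def indicator_def)
    then show ?thesis by (simp only: integrable_restrict_UNIV)
  qed
  obtain N where N: "negligible N"
    "\<And>x e. x \<notin> N \<Longrightarrow> 0 < e \<Longrightarrow> \<exists>d>0. \<forall>h. 0 < h \<and> h < d \<longrightarrow>
        norm (integral (cbox x (x + h *\<^sub>R One)) g /\<^sub>R h ^ DIM(real) - g x) < e"
    by (rule integrable_ccontinuous_explicit[OF intg]) blast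
  show ?thesis
  proof (rule AE_of_negligible[OF N(1)], intro impI allI)
    fix p \<epsilon> :: real assume p: "p \<notin> N" "p \<in> Z" and "\<epsilon> > 0"
    obtain d where d: "d > 0" "\<And>h. 0 < h \<Longrightarrow> h < d \<Longrightarrow>
        norm (integral (cbox p (p + h *\<^sub>R One)) g /\<^sub>R h ^ DIM(real) - g p) < \<epsilon>"
      using N(2)[OF p(1) \<open>\<epsilon> > 0\<close>] by blast
    have "x - z \<le> \<epsilon> * (x - p)"
      if zx: "p \<le> z" "z < x" "x < p + d" "{z<..x} \<inter> Z = {}" for z x
    proof -
      have "norm (integral (cbox p (p + (x - p) *\<^sub>R One)) g /\<^sub>R (x - p) ^ DIM(real) - g p) < \<epsilon>"
        using zx by (intro d(2)) auto
      then have "\<bar>integral {p..x} g / (x - p)\<bar> < \<epsilon>"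
        using p by (simp add: g_def divide_inverse mult.commute)
      then have "integral {p..x} g < \<epsilon> * (x - p)"
        using zx by (simp add: abs_less_iff field_simps)
      moreover have "x - z \<le> integral {p..x} g"
      proof -
        have "x - z = integral {z..x} (\<lambda>x. 1)"
          using zx by simp
        \<comment> \<open>The point \<open>z\<close> may belong to \<open>Z\<close>, so the
          integrands can differ there.\<close>
        also have "\<dots> = integral {z..x} g"
          by (rule integral_spike[of "{z}"]) (use zx in \<open>auto simp: g_def indicator_def disjoint_iff\<close>)
        also have "\<dots> \<le> integral {p..x} g"
          using intg zx by (intro integral_subset_le) (auto simp: g_def box_real[symmetric] simp del: box_real)
        finally show ?thesis .
      qed
      ultimately show ?thesis by linarith
    qed
    with d(1) show "\<exists>d>0. \<forall>z x. p \<le> z \<and> z < x \<and> x < p + d \<and>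
           {z<..x} \<inter> Z = {} \<longrightarrow> x - z \<le> \<epsilon> * (x - p)"
      by blast
  qed
qed

text \<open>Reflection in the origin reduces this to the right-hand version; the reflected
  exceptional set is again negligible, being a differentiable image.\<close>

lemma closed_gaps_small_left:
  fixes Z :: "real set"
  assumes "closed Z"
  shows "AE p in lebesgue. p \<in> Z \<longrightarrow> (\<forall>\<epsilon>>0. \<exists>d>0. \<forall>z x. z \<le> p \<and> x < z \<and> p - d < x \<and>
           {x..<z} \<inter> Z = {} \<longrightarrow> z - x \<le> \<epsilon> * (p - x))"
proof -
  define N where "N = {p. \<not> (p \<in> uminus ` Z \<longrightarrow> (\<forall>\<epsilon>>0. \<exists>d>0. \<forall>z x. p \<le> z \<and> z < x \<and> x < p + d \<and>
           {z<..x} \<inter> uminus ` Z = {} \<longrightarrow> x - z \<le> \<epsilon> * (x - p)))}"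
  have "closed (uminus ` Z)"
    using assms by (rule closed_negations)
  then have "negligible N"
    unfolding N_def by (intro negligible_of_AE closed_gaps_small_right)
  then have "negligible (uminus ` N)"
    by (intro negligible_differentiable_image_negligible)
      (auto intro!: derivative_intros simp: differentiable_on_def)
  then show ?thesis
  proof (rule AE_of_negligible, intro impI allI)
    fix p \<epsilon> :: real assume p: "p \<notin> uminus ` N" "p \<in> Z" and "\<epsilon> > 0"
    then have "-p \<notin> N" "-p \<in> uminus ` Z" by (auto simp: image_iff)
    then obtain d where d: "d > 0" "\<And>z x. -p \<le> z \<Longrightarrow> z < x \<Longrightarrow> x < -p + d \<Longrightarrow>
           {z<..x} \<inter> uminus ` Z = {} \<Longrightarrow> x - z \<le> \<epsilon> * (x - - p)"
      using \<open>\<epsilon> > 0\<close> unfolding N_def by blast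
    have "z - x \<le> \<epsilon> * (p - x)"
      if zx: "z \<le> p" "x < z" "p - d < x" "{x..<z} \<inter> Z = {}" for z x
    proof -
      have "{-z<..-x} \<inter> uminus ` Z = {}" using zx(4) by force
      with d(2)[of "-z" "-x"] zx show ?thesis by simp
    qed
    with d(1) show "\<exists>d>0. \<forall>z x. z \<le> p \<and> x < z \<and> p - d < x \<and>
           {x..<z} \<inter> Z = {} \<longrightarrow> z - x \<le> \<epsilon> * (p - x)"
      by blast
  qed
qed

text \<open>The distance from \<open>x\<close> to a nearest point of \<open>Z\<close> between
  \<open>p\<close> and \<open>x\<close> is of smaller order than the distance to \<open>p\<close>,
  and \<open>k\<close> is controlled by the former. The quantifiers over \<open>k\<close>,
  \<open>L\<close> and \<open>e\<close> stand under the almost everywhere statement: the exceptional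
  set depends on \<open>Z\<close> alone, so the constants may later be chosen depending on
  \<open>p\<close>.\<close>

lemma closed_AE_derivative_zero:
  fixes Z :: "real set"
  assumes Z: "closed Z"
  shows "AE p in lebesgue. p \<in> Z \<longrightarrow> (\<forall>(k::real \<Rightarrow> 'a::real_normed_vector) L e. e > 0 \<longrightarrow> (\<forall>z\<in>Z. k z = 0) \<longrightarrow>
      (\<forall>z x. z \<in> Z \<longrightarrow> \<bar>z - p\<bar> < e \<longrightarrow> \<bar>x - p\<bar> < e \<longrightarrow> open_segment z x \<inter> Z = {} \<longrightarrow>
         norm (k x) \<le> L * \<bar>x - z\<bar>) \<longrightarrow> (k has_vector_derivative 0) (at p))"
  using closed_gaps_small_right[OF Z] closed_gaps_small_left[OF Z]
proof eventually_elim
  case (elim p)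
  show ?case
  proof (intro impI allI)
    fix k :: "real \<Rightarrow> 'a" and L e :: real
    assume p: "p \<in> Z" and e: "e > 0" and k0: "\<forall>z\<in>Z. k z = 0" and
      kL: "\<forall>z x. z \<in> Z \<longrightarrow> \<bar>z - p\<bar> < e \<longrightarrow> \<bar>x - p\<bar> < e \<longrightarrow> open_segment z x \<inter> Z = {} \<longrightarrow>
         norm (k x) \<le> L * \<bar>x - z\<bar>"
    show "(k has_vector_derivative 0) (at p)"
      unfolding has_vector_derivative_def has_derivative_at_alt
    proof (intro conjI allI impI)
      show "bounded_linear (\<lambda>h. h *\<^sub>R (0::'a))" by simp
      fix \<epsilon> :: real assume "\<epsilon> > 0"
      define \<epsilon>' where "\<epsilon>' = \<epsilon> / (\<bar>L\<bar> + 1)"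
      have \<epsilon>': "\<epsilon>' > 0"  "(\<bar>L\<bar> + 1) * \<epsilon>' = \<epsilon>"
        using \<open>\<epsilon> > 0\<close> by (auto simp: \<epsilon>'_def)
      have mono: "L * a \<le> \<epsilon> * b" if "0 \<le> a" "a \<le> \<epsilon>' * b" "0 \<le> b" for a b
      proof -
        have "L * a \<le> \<bar>L\<bar> * a" using that(1) by (simp add: mult_right_mono)
        also have "\<dots> \<le> \<bar>L\<bar> * (\<epsilon>' * b)" using that by (intro mult_left_mono) auto
        also have "\<dots> \<le> (\<bar>L\<bar> + 1) * (\<epsilon>' * b)" using that \<epsilon>' by (intro mult_right_mono) auto
        also have "\<dots> = \<epsilon> * b" using \<epsilon>'(2) by (simp only: mult.assoc[symmetric])
        finally show ?thesis .
      qed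
      obtain d1 where d1: "d1 > 0" "\<And>z x. p \<le> z \<Longrightarrow> z < x \<Longrightarrow> x < p + d1 \<Longrightarrow>
           {z<..x} \<inter> Z = {} \<Longrightarrow> x - z \<le> \<epsilon>' * (x - p)"
        using elim(1) p \<epsilon>'(1) by meson
      obtain d2 where d2: "d2 > 0" "\<And>z x. z \<le> p \<Longrightarrow> x < z \<Longrightarrow> p - d2 < x \<Longrightarrow>
           {x..<z} \<inter> Z = {} \<Longrightarrow> z - x \<le> \<epsilon>' * (p - x)"
        using elim(2) p \<epsilon>'(1) by meson
      have "norm (k x) \<le> \<epsilon> * \<bar>x - p\<bar>" if x: "\<bar>x - p\<bar> < min e (min d1 d2)" for x
      proof -
        consider "x \<in> Z" | "x \<notin> Z" "p < x" | "x \<notin> Z" "x < p"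
          using p by (metis linorder_less_linear)
        then show ?thesis
        proof cases
          case 1
          then show ?thesis using k0 \<open>\<epsilon> > 0\<close> by simp
        next
          case 2
          \<comment> \<open>Closedness of \<open>Z\<close> provides the last point \<open>z\<close>
            of \<open>Z\<close> before \<open>x\<close>; what remains up to \<open>x\<close> is a
            gap.\<close>
          have "compact (Z \<inter> {p..x})"
            using Z by (intro closed_Int_compact) auto
          moreover have "Z \<inter> {p..x} \<noteq> {}"
            using p 2 by auto
          ultimately have "\<exists>z\<in>Z \<inter> {p..x}. \<forall>t\<in>Z \<inter> {p..x}. t \<le> z"
            by (rule compact_attains_sup)
          then obtain z where z: "z \<in> Z \<inter> {p..x}" "\<And>t. t \<in> Z \<inter> {p..x} \<Longrightarrow> t \<le> z"
            by blast
          have zx: "z < x" using z(1) 2 by (metis IntE atLeastAtMost_iff order_le_less)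
          have gap: "{z<..x} \<inter> Z = {}" using z by force
          have "norm (k x) \<le> L * \<bar>x - z\<bar>"
            using z(1) zx gap x 2 by (intro kL[rule_format]) (auto simp: open_segment_eq_real_ivl disjoint_iff)
          also have "\<dots> \<le> \<epsilon> * \<bar>x - p\<bar>"
            using d1(2)[of z x] z(1) zx gap x 2 by (intro mono) auto
          finally show ?thesis .
        next
          case 3
          have "compact (Z \<inter> {x..p})"
            using Z by (intro closed_Int_compact) auto
          moreover have "Z \<inter> {x..p} \<noteq> {}"
            using p 3 by auto
          ultimately have "\<exists>z\<in>Z \<inter> {x..p}. \<forall>t\<in>Z \<inter> {x..p}. z \<le> t"
            by (rule compact_attains_inf)
          then obtain z where z: "z \<in> Z \<inter> {x..p}" "\<And>t. t \<in> Z \<inter> {x..p} \<Longrightarrow> z \<le> t"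
            by blast
          have zx: "x < z" using z(1) 3 by (metis IntE atLeastAtMost_iff order_le_less)
          have gap: "{x..<z} \<inter> Z = {}" using z by force
          have "norm (k x) \<le> L * \<bar>x - z\<bar>"
            using z(1) zx gap x 3 by (intro kL[rule_format]) (auto simp: open_segment_eq_real_ivl disjoint_iff)
          also have "\<dots> \<le> \<epsilon> * \<bar>x - p\<bar>"
            using d2(2)[of z x] z(1) zx gap x 3 by (intro mono) auto
          finally show ?thesis .
        qed
      qed
      then show "\<exists>d>0. \<forall>y. norm (y - p) < d \<longrightarrow> norm (k y - k p - (y - p) *\<^sub>R 0) \<le> \<epsilon> * norm (y - p)"
        using e d1(1) d2(1) p k0 by (intro exI[of _ "min e (min d1 d2)"]) auto
    qed
  qed
qed

text \<open>Where \<open>y = (u, v)\<close> is not differentiable, \<open>vector_derivative\<close> is a fixed junk vector \<open>(c1, c2)\<close>, and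
  the eigenvalue equation becomes the algebraic alternative below. On the closed set \<open>Z\<close> where that
  alternative holds, its two left-hand sides \<open>k1\<close> and \<open>k2\<close> vanish; on the gaps of \<open>Z\<close> the differential
  equation makes them Lipschitz. So they have derivative \<open>0\<close> almost everywhere on \<open>Z\<close>, and solving
  for \<open>u\<close> and \<open>v\<close> (determinant \<open>x\<^sup>2 - \<mu>\<^sup>2\<close>) shows that these are differentiable there after all.\<close>

lemma AE_differentiable_of_ode_or_junk:
  fixes u v :: "real \<Rightarrow> complex" and \<mu> c1 c2 :: complex
  assumes acu: "\<And>a b. absolutely_continuous_on {a..b} u"
    and acv: "\<And>a b. absolutely_continuous_on {a..b} v"
    and ae: "AE x in lebesgue.
      (u has_vector_derivative (of_real x * u x - \<mu> * v x)) (at x) \<and>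
      (v has_vector_derivative (\<mu> * u x - of_real x * v x)) (at x) \<or>
      c2 + of_real x * v x - \<mu> * u x = 0 \<and> - c1 + of_real x * u x - \<mu> * v x = 0"
  shows "AE x in lebesgue. u differentiable (at x) \<and> v differentiable (at x)"
proof -
  define k1 where "k1 x = c2 + of_real x * v x - \<mu> * u x" for x
  define k2 where "k2 x = - c1 + of_real x * u x - \<mu> * v x" for x
  define Z where "Z = {x. k1 x = 0} \<inter> {x. k2 x = 0}"
  note contu = continuous_on_UNIV_if_absolutely_continuous[OF acu]
    and contv = continuous_on_UNIV_if_absolutely_continuous[OF acv]
  have "closed Z"
    unfolding Z_def k1_def k2_def
    by (intro closed_Int closed_Collect_eq continuous_intros contu contv)
  \<comment> \<open>The determinant vanishes for at most two real \<open>x\<close>: equality with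
    \<mu> or its negative forces equality of real parts.\<close>
  have "negligible {x::real. (of_real x)\<^sup>2 = \<mu>\<^sup>2}"
  proof (rule negligible_subset)
    show "negligible {Re \<mu>, - Re \<mu>}" by simp
    show "{x. (complex_of_real x)\<^sup>2 = \<mu>\<^sup>2} \<subseteq> {Re \<mu>, - Re \<mu>}"
      by (auto simp: power2_eq_iff) (metis Re_complex_of_real minus_complex.sel(1) uminus_complex.sel(1))+
  qed
  then have regular: "AE x in lebesgue. (complex_of_real x)\<^sup>2 \<noteq> \<mu>\<^sup>2"
    by (rule AE_of_negligible) simp
  have der: "AE x in lebesgue. x \<notin> Z \<longrightarrow>
      (u has_vector_derivative (of_real x * u x - \<mu> * v x)) (at x) \<and>
      (v has_vector_derivative (\<mu> * u x - of_real x * v x)) (at x)"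
    using ae by eventually_elim (auto simp: Z_def k1_def k2_def)
  show ?thesis
    using der regular closed_AE_derivative_zero[OF \<open>closed Z\<close>, where ?'a=complex]
  proof eventually_elim
    case (elim p)
    show ?case
    proof (cases "p \<in> Z")
      case False
      then show ?thesis using elim(1) by (auto simp: has_vector_derivative_def differentiable_def)
    next
      case True
      define I where "I = {p - 1..p + 1}"
      define R where "R = \<bar>p\<bar> + 1"
      have "bounded (u ` I)" "bounded (v ` I)"
        unfolding I_def using contu contv
        by (meson compact_Icc compact_continuous_image compact_imp_bounded continuous_on_subset subset_UNIV)+
      then obtain Cu Cv where Cuv: "\<forall>x\<in>I. cmod (u x) \<le> Cu" "\<forall>x\<in>I. cmod (v x) \<le> Cv"
        unfolding bounded_iff by auto
      define C where "C = max 0 (max Cu Cv)"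
      have C: "C \<ge> 0" "cmod (u x) \<le> C" "cmod (v x) \<le> C" if "x \<in> I" for x
        using Cuv that by (force simp: C_def)+
      have pI: "p \<in> I" by (simp add: I_def)
      \<comment> \<open>\<open>K\<close> bounds both right-hand sides of the differential system on
        \<open>I\<close>, hence both derivatives at almost every point of a gap.\<close>
      define K where "K = (R + cmod \<mu>) * C"
      have "R \<ge> 0" by (simp add: R_def)
      have "K \<ge> 0" using C(1)[OF pI] \<open>R \<ge> 0\<close> by (simp add: K_def)
      have RI: "\<bar>x\<bar> \<le> R" if "x \<in> I" for x using that by (auto simp: I_def R_def)
      have F: "cmod (of_real x * a - \<mu> * b) \<le> (R + cmod \<mu>) * D" "cmod (\<mu> * b - of_real x * a) \<le> (R + cmod \<mu>) * D"
        if "x \<in> I" "cmod a \<le> D" "cmod b \<le> D" for x a b D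
      proof -
        have "cmod (of_real x * a - \<mu> * b) \<le> \<bar>x\<bar> * cmod a + cmod \<mu> * cmod b"
          by (metis norm_mult norm_of_real norm_triangle_ineq4)
        also have "\<dots> \<le> R * D + cmod \<mu> * D"
          using that RI[OF that(1)] \<open>R \<ge> 0\<close> by (intro add_mono mult_mono) auto
        finally show "cmod (of_real x * a - \<mu> * b) \<le> (R + cmod \<mu>) * D"
          by (simp add: algebra_simps)
        then show "cmod (\<mu> * b - of_real x * a) \<le> (R + cmod \<mu>) * D"
          by (simp add: norm_minus_commute)
      qed
      have lip: "cmod (u x - u z) \<le> K * \<bar>x - z\<bar> \<and> cmod (v x - v z) \<le> K * \<bar>x - z\<bar>"
        if "x \<in> I" "z \<in> I" "open_segment z x \<inter> Z = {}" for x z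
      proof -
        have *: "cmod (u b - u a) \<le> K * (b - a) \<and> cmod (v b - v a) \<le> K * (b - a)"
          if ab: "a \<in> I" "b \<in> I" "a \<le> b" "{a<..<b} \<inter> Z = {}" for a b
        proof -
          have sub: "x \<in> I" if "x \<in> {a<..<b}" for x using that ab by (auto simp: I_def)
          have "norm (u b - u a - (b - a) *\<^sub>R 0) \<le> K * (b - a)"
          proof (rule absolutely_continuous_mean_value[OF acu ab(3) \<open>K \<ge> 0\<close>])
            show "AE x in lebesgue. x \<in> {a<..<b} \<longrightarrow>
                (\<exists>d. (u has_vector_derivative d) (at x) \<and> cmod (d - 0) \<le> K)"
              using der
            proof eventually_elim
              case (elim x)
              show ?case
              proof
                assume x: "x \<in> {a<..<b}"
                with ab have "x \<notin> Z" by blast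
                with elim F(1)[OF sub[OF x] C(2)[OF sub[OF x]] C(3)[OF sub[OF x]]]
                show "\<exists>d. (u has_vector_derivative d) (at x) \<and> cmod (d - 0) \<le> K"
                  by (auto simp: K_def)
              qed
            qed
          qed
          moreover have "norm (v b - v a - (b - a) *\<^sub>R 0) \<le> K * (b - a)"
          proof (rule absolutely_continuous_mean_value[OF acv ab(3) \<open>K \<ge> 0\<close>])
            show "AE x in lebesgue. x \<in> {a<..<b} \<longrightarrow>
                (\<exists>d. (v has_vector_derivative d) (at x) \<and> cmod (d - 0) \<le> K)"
              using der
            proof eventually_elim
              case (elim x)
              show ?case
              proof
                assume x: "x \<in> {a<..<b}"
                with ab have "x \<notin> Z" by blast
                with elim F(2)[OF sub[OF x] C(3)[OF sub[OF x]] C(2)[OF sub[OF x]]]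
                show "\<exists>d. (v has_vector_derivative d) (at x) \<and> cmod (d - 0) \<le> K"
                  by (auto simp: K_def)
              qed
            qed
          qed
          ultimately show ?thesis by simp
        qed
        show ?thesis
          using *[of x z] *[of z x] that
          by (cases "z \<le> x") (auto simp: open_segment_eq_real_ivl norm_minus_commute split: if_splits)
      qed
      \<comment> \<open>In \<open>k1 x - k1 z\<close> and \<open>k2 x - k2 z\<close>, the increments
        of \<open>u\<close> and \<open>v\<close> contribute the first summand, the increment of the
        coefficient \<open>x\<close> contributes \<open>C\<close>.\<close>
      define L where "L = (R + cmod \<mu>) * K + C"
      have kL: "cmod (k1 x) \<le> L * \<bar>x - z\<bar>" "cmod (k2 x) \<le> L * \<bar>x - z\<bar>"
        if xz: "z \<in> Z" "x \<in> I" "z \<in> I" "open_segment z x \<inter> Z = {}" for x z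
      proof -
        note l = lip[OF xz(2,3,4)]
        have "k1 x = k1 x - k1 z" using xz by (simp add: Z_def)
        also have "\<dots> = (of_real x * (v x - v z) - \<mu> * (u x - u z)) + of_real (x - z) * v z"
          by (simp add: k1_def algebra_simps)
        also have "cmod \<dots> \<le> (R + cmod \<mu>) * (K * \<bar>x - z\<bar>) + \<bar>x - z\<bar> * C"
          using F(1)[OF xz(2), of "v x - v z" _ "u x - u z"] l C(3)[OF xz(3)]
          by (intro norm_triangle_mono) (auto simp: norm_mult simp del: of_real_diff intro: mult_left_mono)
        finally show "cmod (k1 x) \<le> L * \<bar>x - z\<bar>" by (simp add: L_def algebra_simps)
        have "k2 x = k2 x - k2 z" using xz by (simp add: Z_def)
        also have "\<dots> = (of_real x * (u x - u z) - \<mu> * (v x - v z)) + of_real (x - z) * u z"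
          by (simp add: k2_def algebra_simps)
        also have "cmod \<dots> \<le> (R + cmod \<mu>) * (K * \<bar>x - z\<bar>) + \<bar>x - z\<bar> * C"
          using F(1)[OF xz(2), of "u x - u z" _ "v x - v z"] l C(2)[OF xz(3)]
          by (intro norm_triangle_mono) (auto simp: norm_mult simp del: of_real_diff intro: mult_left_mono)
        finally show "cmod (k2 x) \<le> L * \<bar>x - z\<bar>" by (simp add: L_def algebra_simps)
      qed
      have nbI: "x \<in> I" if "\<bar>x - p\<bar> < 1" for x using that by (auto simp: I_def)
      have "(k1 has_vector_derivative 0) (at p)"
        by (rule elim(3)[rule_format, OF True, of 1 k1 L])
          (auto simp: Z_def intro!: kL(1)[unfolded Z_def] nbI)
      moreover have "(k2 has_vector_derivative 0) (at p)"
        by (rule elim(3)[rule_format, OF True, of 1 k2 L])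
          (auto simp: Z_def intro!: kL(2)[unfolded Z_def] nbI)
      ultimately have dk: "k1 differentiable (at p)" "k2 differentiable (at p)"
        by (auto simp: has_vector_derivative_def differentiable_def)
      have dof: "(complex_of_real) differentiable (at p)"
        by (simp add: bounded_linear_of_real bounded_linear_imp_differentiable)
      define S where "S = {x::real. (of_real x)\<^sup>2 \<noteq> \<mu>\<^sup>2}"
      have "open S" unfolding S_def by (intro open_Collect_neq continuous_intros)
      have pS: "p \<in> S" using elim(2) by (simp add: S_def)
      \<comment> \<open>Cramer's rule for the linear system with right-hand sides \<open>k1\<close>
        and \<open>k2\<close>, after the junk constants \<open>c1\<close> and \<open>c2\<close> are
        moved across.\<close>
      have equ: "(\<mu> * k1 x + of_real x * k2 x - \<mu> * c2 + of_real x * c1) / ((of_real x)\<^sup>2 - \<mu>\<^sup>2) = u x"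
        if "x \<in> S" for x
      proof -
        have "\<mu> * k1 x + of_real x * k2 x - \<mu> * c2 + of_real x * c1 = u x * ((of_real x)\<^sup>2 - \<mu>\<^sup>2)"
          by (simp add: k1_def k2_def algebra_simps power2_eq_square)
        then show ?thesis using that by (simp add: S_def)
      qed
      have eqv: "(of_real x * k1 x + \<mu> * k2 x - of_real x * c2 + \<mu> * c1) / ((of_real x)\<^sup>2 - \<mu>\<^sup>2) = v x"
        if "x \<in> S" for x
      proof -
        have "of_real x * k1 x + \<mu> * k2 x - of_real x * c2 + \<mu> * c1 = v x * ((of_real x)\<^sup>2 - \<mu>\<^sup>2)"
          by (simp add: k1_def k2_def algebra_simps power2_eq_square)
        then show ?thesis using that by (simp add: S_def)
      qed
      have transfer: "g differentiable (at p)"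
        if "f differentiable (at p)" "\<And>x. x \<in> S \<Longrightarrow> f x = g x" for f g :: "real \<Rightarrow> complex"
        using that has_derivative_transform_within_open[OF _ \<open>open S\<close> pS]
        unfolding differentiable_def by metis
      have "u differentiable (at p)"
        by (rule transfer[OF _ equ]) (use pS in \<open>auto simp: S_def intro!: derivative_intros dk dof\<close>)
      moreover have "v differentiable (at p)"
        by (rule transfer[OF _ eqv]) (use pS in \<open>auto simp: S_def intro!: derivative_intros dk dof\<close>)
      ultimately show ?thesis by blast
    qed
  qed
qed

section \<open>From the vector equation to a classical scalar system\<close>

lemma vec2_eq_iff: "(x :: 'a^2) = y \<longleftrightarrow> x $ 1 = y $ 1 \<and> x $ 2 = y $ 2"
  by (simp add: vec_eq_iff forall_2)

lemma dirac_expr_nth: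
  "dirac_expr y x $ 1 = vector_derivative y (at x) $ 2 + of_real x * y x $ 2"
  "dirac_expr y x $ 2 = - vector_derivative y (at x) $ 1 + of_real x * y x $ 1"
  by (simp_all add: dirac_expr_def B_mat_def Omega0_def matrix_vector_mult_def sum_2)

lemma has_vector_derivative_vec2:
  fixes y :: "real \<Rightarrow> complex^2"
  shows "(y has_vector_derivative d) F \<longleftrightarrow>
    ((\<lambda>x. y x $ 1) has_vector_derivative d $ 1) F \<and> ((\<lambda>x. y x $ 2) has_vector_derivative d $ 2) F"
proof safe
  assume "(y has_vector_derivative d) F"
  note * = bounded_linear.has_vector_derivative[OF bounded_linear_vec_nth this]
  show "((\<lambda>x. y x $ 1) has_vector_derivative d $ 1) F" by (rule *)
  show "((\<lambda>x. y x $ 2) has_vector_derivative d $ 2) F" by (rule *)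
next
  assume 1: "((\<lambda>x. y x $ 1) has_vector_derivative d $ 1) F"
    and 2: "((\<lambda>x. y x $ 2) has_vector_derivative d $ 2) F"
  have lin: "bounded_linear (\<lambda>c::complex. axis i c :: complex^2)" for i
    by (intro linear_conv_bounded_linear[THEN iffD1] linearI) (auto simp: axis_def vec_eq_iff)
  have "((\<lambda>x. axis 1 (y x $ 1) + axis 2 (y x $ 2) :: complex^2)
      has_vector_derivative axis 1 (d $ 1) + axis 2 (d $ 2)) F"
    by (intro has_vector_derivative_add bounded_linear.has_vector_derivative[OF lin] 1 2)
  moreover have "axis 1 (w $ 1) + axis 2 (w $ 2) = w" for w :: "complex^2"
    by (simp add: vec2_eq_iff axis_def)
  ultimately show "(y has_vector_derivative d) F" by simp
qed

text \<open>At almost every point either the derivative is genuine or the junk relation holds. This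
  gives differentiability almost everywhere, hence the scalar system almost everywhere; its
  right-hand sides are continuous, so it holds at every point.\<close>

lemma dirac_eigenfunction_imp_ode:
  assumes "dirac_eigenfunction \<mu> y"
  shows "((\<lambda>x. y x $ 1) has_vector_derivative of_real x * y x $ 1 - \<mu> * y x $ 2) (at x)" (is ?A)
    and "((\<lambda>x. y x $ 2) has_vector_derivative \<mu> * y x $ 1 - of_real x * y x $ 2) (at x)" (is ?B)
proof -
  have ac: "absolutely_continuous_on {a..b} (\<lambda>x. y x $ k)" for a b k
    using assms by (simp add: dirac_eigenfunction_def dirac_domain_def)
  have ae: "AE x in lebesgue. dirac_expr y x = \<mu> *s y x"
    using assms by (simp add: dirac_eigenfunction_def)
  \<comment> \<open>At a point of non-differentiability the predicate under the choice operator is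
    constantly false, so the chosen vector is the same at all such points.\<close>
  define c where "c = (SOME d :: complex^2. False)"
  have junk: "vector_derivative y (at x) = c" if "\<not> (\<exists>d. (y has_vector_derivative d) (at x))" for x
    using that by (simp add: vector_derivative_def c_def)
  have der: "((\<lambda>x. y x $ 1) has_vector_derivative (of_real x * y x $ 1 - \<mu> * y x $ 2)) (at x) \<and>
      ((\<lambda>x. y x $ 2) has_vector_derivative (\<mu> * y x $ 1 - of_real x * y x $ 2)) (at x)"
    if "dirac_expr y x = \<mu> *s y x" "(y has_vector_derivative d) (at x)" for x d
  proof -
    have "vector_derivative y (at x) = d"
      using that(2) by (rule vector_derivative_at)
    then have "d $ 2 + of_real x * y x $ 2 = \<mu> * y x $ 1" "- d $ 1 + of_real x * y x $ 1 = \<mu> * y x $ 2"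
      using that(1) by (simp_all add: vec2_eq_iff dirac_expr_nth)
    then have "d $ 1 = of_real x * y x $ 1 - \<mu> * y x $ 2" "d $ 2 = \<mu> * y x $ 1 - of_real x * y x $ 2"
      by (simp_all add: algebra_simps)
    then show ?thesis using that(2) by (simp add: has_vector_derivative_vec2)
  qed
  have "AE x in lebesgue. (\<lambda>x. y x $ 1) differentiable (at x) \<and> (\<lambda>x. y x $ 2) differentiable (at x)"
  proof (rule AE_differentiable_of_ode_or_junk[OF ac ac])
    show "AE x in lebesgue.
      ((\<lambda>x. y x $ 1) has_vector_derivative (of_real x * y x $ 1 - \<mu> * y x $ 2)) (at x) \<and>
      ((\<lambda>x. y x $ 2) has_vector_derivative (\<mu> * y x $ 1 - of_real x * y x $ 2)) (at x) \<or>
      c $ 2 + of_real x * y x $ 2 - \<mu> * y x $ 1 = 0 \<and> - c $ 1 + of_real x * y x $ 1 - \<mu> * y x $ 2 = 0"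
      using ae
    proof eventually_elim
      case (elim x)
      show ?case
      proof (cases "\<exists>d. (y has_vector_derivative d) (at x)")
        case True
        then show ?thesis using der[OF elim] by blast
      next
        case False
        then show ?thesis using elim by (simp add: vec2_eq_iff dirac_expr_nth junk)
      qed
    qed
  qed
  with ae have ode: "AE x in lebesgue.
      ((\<lambda>x. y x $ 1) has_vector_derivative (of_real x * y x $ 1 - \<mu> * y x $ 2)) (at x) \<and>
      ((\<lambda>x. y x $ 2) has_vector_derivative (\<mu> * y x $ 1 - of_real x * y x $ 2)) (at x)"
  proof eventually_elim
    case (elim x)
    then have "(y has_vector_derivative
        (\<chi> i. if i = 1 then vector_derivative (\<lambda>x. y x $ 1) (at x) else vector_derivative (\<lambda>x. y x $ 2) (at x))) (at x)"
      by (simp add: has_vector_derivative_vec2 vector_derivative_works)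
    then show ?case using der elim by blast
  qed
  note cont = continuous_on_UNIV_if_absolutely_continuous[OF ac]
  show ?A
    by (rule has_vector_derivative_of_AE[OF ac]) (use ode in \<open>auto intro!: continuous_intros cont\<close>)
  show ?B
    by (rule has_vector_derivative_of_AE[OF ac]) (use ode in \<open>auto intro!: continuous_intros cont\<close>)
qed

section \<open>Hermite functions\<close>

text \<open>The recursion is minus the effect on \<open>p\<close> of differentiating
  \<open>poly p x * exp (- x\<^sup>2)\<close>. Working with polynomials makes derivatives algebraic
  and reduces integrability to Gaussian moments.\<close>

primrec hermite_poly :: "nat \<Rightarrow> real poly" where
  "hermite_poly 0 = 1"
| "hermite_poly (Suc n) = [:0, 2:] * hermite_poly n - pderiv (hermite_poly n)"

lemma pderiv_hermite_poly_Suc: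
  "pderiv (hermite_poly (Suc n)) = smult (2 * real (Suc n)) (hermite_poly n)"
proof (induction n)
  case 0
  show ?case by (simp add: pderiv_pCons)
next
  case (Suc n)
  have "pderiv (hermite_poly (Suc (Suc n))) =
      smult 2 (hermite_poly (Suc n)) + [:0, 2:] * pderiv (hermite_poly (Suc n)) - pderiv (pderiv (hermite_poly (Suc n)))"
    by (subst hermite_poly.simps(2)) (simp add: pderiv_diff pderiv_mult pderiv_pCons pderiv_smult del: hermite_poly.simps)
  also have "\<dots> = smult 2 (hermite_poly (Suc n))
      + smult (2 * real (Suc n)) ([:0, 2:] * hermite_poly n - pderiv (hermite_poly n))"
    by (simp add: Suc pderiv_smult smult_diff_right del: hermite_poly.simps)
  also have "\<dots> = smult (2 * real (Suc (Suc n))) (hermite_poly (Suc n))"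
    by (simp add: smult_add_left[symmetric] del: hermite_poly.simps) (simp flip: smult_add_left)
  finally show ?case .
qed

lemma deriv_pow_gaussian:
  "(deriv ^^ n) (\<lambda>t. exp (- t\<^sup>2)) = (\<lambda>x::real. (-1) ^ n * (poly (hermite_poly n) x * exp (- x\<^sup>2)))"
proof (induction n)
  case (Suc n)
  have "((\<lambda>x. (-1) ^ n * (poly (hermite_poly n) x * exp (- x\<^sup>2))) has_real_derivative
      (-1) ^ Suc n * (poly (hermite_poly (Suc n)) x * exp (- x\<^sup>2))) (at x)" for x :: real
    by (auto intro!: derivative_eq_intros poly_DERIV simp: algebra_simps)
  then show ?case
    by (simp add: Suc DERIV_imp_deriv fun_eq_iff del: hermite_poly.simps)
qed simp

lemma hermite_H_eq_poly: "hermite_H n x = poly (hermite_poly n) x"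
proof -
  have "(-1) ^ n * ((-1) ^ n * p) = (p :: real)" for p
    by (simp add: mult.assoc[symmetric] power_mult_distrib[symmetric])
  moreover have "exp (x\<^sup>2) * exp (- x\<^sup>2) = 1"
    by (simp add: exp_add[symmetric])
  ultimately show ?thesis
    by (simp add: hermite_H_def deriv_pow_gaussian mult_ac)
qed

text \<open>This ratio of normalizing constants is what gives raising and lowering the same
  factor.\<close>

lemma hermite_C_Suc: "hermite_C n = sqrt (2 * real (Suc n)) * hermite_C (Suc n)"
proof -
  have "2 ^ Suc n * fact (Suc n) * sqrt pi = (2 * real (Suc n)) * (2 ^ n * fact n * sqrt pi)"
    by (simp add: algebra_simps)
  then show ?thesis
    by (simp only: hermite_C_def real_sqrt_mult[of "2 * real (Suc n)"]) simp
qed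

lemma hermite_phi_eq_poly:
  "hermite_phi n = (\<lambda>x. hermite_C n * exp (- x\<^sup>2 / 2) * poly (hermite_poly n) x)"
  by (simp add: fun_eq_iff hermite_phi_def hermite_H_eq_poly)

lemma has_derivative_hermite_phi_poly:
  "(hermite_phi n has_real_derivative
     hermite_C n * exp (- x\<^sup>2 / 2) * (poly (pderiv (hermite_poly n)) x - x * poly (hermite_poly n) x)) (at x)"
  unfolding hermite_phi_eq_poly
  by (auto intro!: derivative_eq_intros poly_DERIV simp: algebra_simps power2_eq_square)

text \<open>In operator form, \<open>A*\<close> sends the n-th function to
  \<open>sqrt (2 * real (Suc n))\<close> times the next one; this is the recursion of
  \<open>hermite_poly\<close> multiplied by the Gaussian. The companion
  \<open>hermite_phi_lower\<close> does the same for \<open>A\<close> and rests on the derivative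
  formula for the polynomials.\<close>

lemma hermite_phi_raise:
  "(hermite_phi n has_real_derivative
     x * hermite_phi n x - sqrt (2 * real (Suc n)) * hermite_phi (Suc n) x) (at x)"
  using has_derivative_hermite_phi_poly[of n x]
  by (simp add: hermite_phi_eq_poly hermite_C_Suc[of n] algebra_simps)

lemma hermite_phi_lower:
  "(hermite_phi (Suc n) has_real_derivative
     sqrt (2 * real (Suc n)) * hermite_phi n x - x * hermite_phi (Suc n) x) (at x)"
proof -
  have "hermite_C (Suc n) * (2 * real (Suc n)) = hermite_C n * sqrt (2 * real (Suc n))"
    by (simp add: hermite_C_Suc[of n] real_sqrt_mult_self)
  then have "hermite_C (Suc n) * E * (poly (pderiv (hermite_poly (Suc n))) x - x * p) =
      sqrt (2 * real (Suc n)) * (hermite_C n * E * poly (hermite_poly n) x) - x * (hermite_C (Suc n) * E * p)"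
    for E p
    unfolding pderiv_hermite_poly_Suc by (simp only: poly_smult) (algebra)
  then show ?thesis
    using has_derivative_hermite_phi_poly[of "Suc n" x] by (simp only: hermite_phi_eq_poly)
qed

lemma hermite_phi_0: "hermite_phi 0 = (\<lambda>x. hermite_C 0 * exp (- x\<^sup>2 / 2))"
  by (simp add: hermite_phi_eq_poly)

lemma hermite_C_pos: "hermite_C n > 0"
  by (simp add: hermite_C_def)

lemma hermite_phi_lower_0: "(hermite_phi 0 has_real_derivative - x * hermite_phi 0 x) (at x)"
  using has_derivative_hermite_phi_poly[of 0 x] by (simp add: hermite_phi_0 mult_ac)

text \<open>Lowering carries identical vanishing down to the Gaussian \<open>hermite_phi 0\<close>,
  which is positive.\<close>

lemma hermite_phi_nonzero: "hermite_phi n \<noteq> (\<lambda>x. 0)"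
proof (induction n)
  case 0
  show ?case using hermite_C_pos[of 0] by (simp add: hermite_phi_0 fun_eq_iff)
next
  case (Suc n)
  show ?case
  proof
    assume 0: "hermite_phi (Suc n) = (\<lambda>x. 0)"
    have "hermite_phi n x = 0" for x
    proof -
      have "sqrt (2 * real (Suc n)) * hermite_phi n x = 0"
        using DERIV_unique[OF hermite_phi_lower[of n x, unfolded 0] DERIV_const] by simp
      then show ?thesis by (simp del: of_nat_Suc)
    qed
    then show False using Suc by auto
  qed
qed

lemma continuous_on_hermite_phi: "continuous_on A (hermite_phi n)"
  unfolding hermite_phi_eq_poly by (intro continuous_intros) auto

section \<open>Square integrability of the Hermite functions\<close>

lemma integrable_gaussian_poly:
  "integrable lborel (\<lambda>x::real. exp (- x\<^sup>2) * poly p x)"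
proof -
  have mono: "integrable lborel (\<lambda>x::real. exp (- x\<^sup>2) * x ^ k)" for k
  proof -
    \<comment> \<open>With variance 1/2 the normal density is
      \<open>exp (- x\<^sup>2) / sqrt pi\<close>.\<close>
    define s where "s = 1 / sqrt 2"
    have s: "s > 0" "2 * s\<^sup>2 = 1" by (simp_all add: s_def power_divide)
    have "integrable lborel (\<lambda>x. sqrt pi * (normal_density 0 s x * (x - 0) ^ k))"
      by (intro integrable_mult_right integrable_normal_moment s)
    also have "(\<lambda>x. sqrt pi * (normal_density 0 s x * (x - 0) ^ k)) = (\<lambda>x. exp (- x\<^sup>2) * x ^ k)"
    proof -
      have "2 * pi * s\<^sup>2 = pi" using s(2) by (simp add: mult_ac)
      then show ?thesis using s(2) by (simp only: normal_density_def) simp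
    qed
    finally show ?thesis .
  qed
  have "integrable lborel (\<lambda>x::real. \<Sum>i\<le>degree p. coeff p i * (exp (- x\<^sup>2) * x ^ i))"
    by (intro Bochner_Integration.integrable_sum integrable_mult_right mono)
  then show ?thesis
    by (simp add: poly_altdef sum_distrib_left mult_ac)
qed

lemma integrable_hermite_phi_square: "integrable lebesgue (\<lambda>x. (hermite_phi n x)\<^sup>2)"
proof -
  have "(hermite_phi n x)\<^sup>2 = exp (- x\<^sup>2) * poly (smult ((hermite_C n)\<^sup>2) ((hermite_poly n)\<^sup>2)) x" for x
  proof -
    have "(exp (- x\<^sup>2 / 2))\<^sup>2 = exp (- x\<^sup>2)"
      by (simp add: power2_eq_square exp_add[symmetric])
    then show ?thesis
      by (simp add: hermite_phi_eq_poly power_mult_distrib)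
  qed
  then have "integrable lborel (\<lambda>x. (hermite_phi n x)\<^sup>2)"
    by (simp only: integrable_gaussian_poly)
  then show ?thesis
    by (subst integrable_completion) (auto intro!: borel_measurable_power borel_measurable_continuous_onI continuous_on_hermite_phi)
qed

lemma square_integrable_hermite_phi: "square_integrable (\<lambda>x. c * of_real (hermite_phi n x))"
proof -
  have "continuous_on UNIV (\<lambda>x. c * of_real (hermite_phi n x) :: complex)"
    by (intro continuous_intros continuous_on_hermite_phi)
  then have "(\<lambda>x. c * of_real (hermite_phi n x)) \<in> borel_measurable lebesgue"
    by (intro measurable_completion) (simp add: borel_measurable_continuous_onI)
  moreover have "integrable lebesgue (\<lambda>x. (cmod c)\<^sup>2 * (hermite_phi n x)\<^sup>2)"
    by (intro integrable_mult_right integrable_hermite_phi_square)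
  ultimately show ?thesis
    by (simp add: square_integrable_def norm_mult power_mult_distrib)
qed

section \<open>The ladder of square integrable solutions\<close>

text \<open>For a continuous nonnegative \<open>w\<close> this is integrability over the whole line,
  in a form that differentiation rules can handle.\<close>

definition bounded_primitive :: "(real \<Rightarrow> real) \<Rightarrow> bool" where
  "bounded_primitive w \<longleftrightarrow>
     (\<exists>F B. (\<forall>x. (F has_real_derivative w x) (at x)) \<and> (\<forall>x. \<bar>F x\<bar> \<le> B))"

lemma bounded_primitiveE:
  assumes "bounded_primitive w"
  obtains F B where "\<And>x. (F has_real_derivative w x) (at x)" "\<And>x. \<bar>F x\<bar> \<le> B"
  using assms unfolding bounded_primitive_def by blast

lemma bounded_primitive_add:
  assumes "bounded_primitive v" "bounded_primitive w"
  shows "bounded_primitive (\<lambda>x. v x + w x)"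
proof -
  obtain F A where F: "\<And>x. (F has_real_derivative v x) (at x)" "\<And>x. \<bar>F x\<bar> \<le> A"
    using assms(1) by (rule bounded_primitiveE) blast
  obtain G B where G: "\<And>x. (G has_real_derivative w x) (at x)" "\<And>x. \<bar>G x\<bar> \<le> B"
    using assms(2) by (rule bounded_primitiveE) blast
  have "((\<lambda>x. F x + G x) has_real_derivative v x + w x) (at x)" for x
    by (intro DERIV_add F G)
  moreover have "\<bar>F x + G x\<bar> \<le> A + B" for x
    using F(2)[of x] G(2)[of x] by linarith
  ultimately show ?thesis unfolding bounded_primitive_def by blast
qed

text \<open>Otherwise \<open>w T + w (-T) > 1 / T\<close> for all large \<open>T\<close>, and the primitive would outgrow
  the logarithm.\<close>

lemma bounded_primitive_small:
  assumes "bounded_primitive w"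
  shows "\<exists>T\<ge>T0. T \<ge> 1 \<and> T * (w T + w (- T)) \<le> 1"
proof (rule ccontr)
  assume neg: "\<not> ?thesis"
  define t where "t = max T0 1"
  have "t \<ge> 1" by (simp add: t_def)
  have large: "w T + w (- T) \<ge> 1 / T" if "T \<ge> t" for T
  proof -
    have "T > 0" using that \<open>t \<ge> 1\<close> by simp
    moreover have "T * (w T + w (- T)) > 1" using neg that by (force simp: t_def)
    ultimately show ?thesis by (simp add: field_simps)
  qed
  obtain F B where F: "\<And>x. (F has_real_derivative w x) (at x)" "\<And>x. \<bar>F x\<bar> \<le> B"
    using assms by (rule bounded_primitiveE) blast
  define S where "S x = F x - F (- x) - ln x" for x
  have B: "B \<ge> 0" using F(2)[of 0] by linarith
  \<comment> \<open>\<open>S\<close> is nondecreasing, so \<open>F x - F (- x)\<close> gains at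
    least \<open>ln u - ln t\<close> between \<open>t\<close> and \<open>u\<close>. The bounds on
    \<open>F\<close> permit a gain of at most \<open>4 * B\<close>, and this \<open>u\<close>
    demands one more.\<close>
  define u where "u = t * exp (4 * B + 1)"
  have "t \<le> u"
    using \<open>t \<ge> 1\<close> B by (simp add: u_def)
  have "S t \<le> S u"
  proof (rule DERIV_nonneg_imp_nondecreasing[OF \<open>t \<le> u\<close>])
    fix x assume x: "t \<le> x" "x \<le> u"
    have "((\<lambda>x. F (- x)) has_real_derivative w (- x) * (- 1)) (at x)"
      by (rule DERIV_chain2[OF F(1)]) (auto intro!: derivative_eq_intros)
    then have "(S has_real_derivative w x - w (- x) * (- 1) - 1 / x) (at x)"
      unfolding S_def using x \<open>t \<ge> 1\<close> by (auto intro!: derivative_eq_intros F(1))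
    moreover have "w x - w (- x) * (- 1) - 1 / x \<ge> 0"
      using large[OF x(1)] by simp
    ultimately show "\<exists>y. (S has_real_derivative y) (at x) \<and> 0 \<le> y" by blast
  qed
  moreover have "ln u = ln t + (4 * B + 1)"
    using \<open>t \<ge> 1\<close> by (simp add: u_def ln_mult)
  ultimately show False
    using F(2)[of t] F(2)[of "- t"] F(2)[of u] F(2)[of "- u"] by (simp add: S_def)
qed

lemma zero_vector_derivative_imp_constant:
  fixes f :: "real \<Rightarrow> 'a::real_normed_vector"
  assumes "\<And>x. (f has_vector_derivative 0) (at x)"
  shows "f x = f y"
proof -
  obtain c where "\<And>x. x \<in> UNIV \<Longrightarrow> f x = c"
    using assms by (auto intro: has_vector_derivative_zero_constant[of UNIV f])
  then show ?thesis by simp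
qed

text \<open>The assumptions say \<open>g = A f\<close> and \<open>A* g = \<nu> f\<close>: the
  second-order equation as a first-order system. The parameter is complex because its reality is a
  conclusion, drawn in \<open>eigenvalue_nonneg\<close>.\<close>

locale ladder =
  fixes f g :: "real \<Rightarrow> complex" and \<nu> :: complex
  assumes f_deriv: "\<And>x. (f has_vector_derivative g x - of_real x * f x) (at x)"
    and g_deriv: "\<And>x. (g has_vector_derivative of_real x * g x - \<nu> * f x) (at x)"
begin

text \<open>The local form of the symmetry of \<open>A\<close> and \<open>A*\<close>: the terms with
  the coefficient \<open>x\<close> cancel, and \<open>g x * cnj (f x)\<close> is the boundary term
  of the integration by parts.\<close>

lemma pairing_deriv:
  "((\<lambda>x. g x * cnj (f x)) has_vector_derivative
     of_real ((cmod (g x))\<^sup>2) - \<nu> * of_real ((cmod (f x))\<^sup>2)) (at x)"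
proof -
  have "((\<lambda>x. g x * cnj (f x)) has_vector_derivative
     g x * cnj (g x - of_real x * f x) + (of_real x * g x - \<nu> * f x) * cnj (f x)) (at x)"
    by (intro has_vector_derivative_mult has_vector_derivative_cnj f_deriv g_deriv)
  moreover have "g x * cnj (g x - of_real x * f x) + (of_real x * g x - \<nu> * f x) * cnj (f x)
      = of_real ((cmod (g x))\<^sup>2) - \<nu> * of_real ((cmod (f x))\<^sup>2)"
    unfolding complex_norm_square by (simp add: algebra_simps)
  ultimately show ?thesis by simp
qed

lemma pairing_eq:
  assumes F: "\<And>x. (F has_real_derivative (cmod (f x))\<^sup>2) (at x)"
    and G: "\<And>x. (G has_real_derivative (cmod (g x))\<^sup>2) (at x)"
  shows "\<exists>c. \<forall>x. g x * cnj (f x) = of_real (G x) - \<nu> * of_real (F x) + c"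
proof -
  have "((\<lambda>x. g x * cnj (f x) - (of_real (G x) - \<nu> * of_real (F x))) has_vector_derivative
      (of_real ((cmod (g x))\<^sup>2) - \<nu> * of_real ((cmod (f x))\<^sup>2))
      - (of_real ((cmod (g x))\<^sup>2) - \<nu> * of_real ((cmod (f x))\<^sup>2))) (at x)" for x
    by (intro has_vector_derivative_diff pairing_deriv has_vector_derivative_mult_right
        has_vector_derivative_of_real F G)
  then have "g x * cnj (f x) - (of_real (G x) - \<nu> * of_real (F x)) =
      g 0 * cnj (f 0) - (of_real (G 0) - \<nu> * of_real (F 0))" for x
    by (intro zero_vector_derivative_imp_constant) simp
  then show ?thesis
    by (intro exI[of _ "g 0 * cnj (f 0) - (of_real (G 0) - \<nu> * of_real (F 0))"] allI)
      (metis add.commute diff_add_cancel)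
qed

text \<open>Over a symmetric interval, the integral of the squared modulus of \<open>g\<close>
  differs from \<nu> times that of \<open>f\<close> only by boundary terms, which become arbitrarily
  small along suitable T. The integral for \<open>f\<close> stays above a positive constant and that
  for \<open>g\<close> is nonnegative, so \<nu> can have neither an imaginary part nor a negative
  real part.\<close>

lemma eigenvalue_nonneg:
  assumes "bounded_primitive (\<lambda>x. (cmod (f x))\<^sup>2)" "bounded_primitive (\<lambda>x. (cmod (g x))\<^sup>2)"
    and "f x0 \<noteq> 0"
  shows "Im \<nu> = 0 \<and> Re \<nu> \<ge> 0"
proof -
  obtain F B where F: "\<And>x. (F has_real_derivative (cmod (f x))\<^sup>2) (at x)" "\<And>x. \<bar>F x\<bar> \<le> B"
    using assms(1) by (rule bounded_primitiveE) blast
  obtain G where G: "\<And>x. (G has_real_derivative (cmod (g x))\<^sup>2) (at x)"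
    using assms(2) by (rule bounded_primitiveE) blast
  obtain c where c: "\<And>x. g x * cnj (f x) = of_real (G x) - \<nu> * of_real (F x) + c"
    using pairing_eq[OF F(1) G] by blast
  have mono: "a \<le> b \<Longrightarrow> P a \<le> P b" if "\<And>x. (P has_real_derivative (cmod (h x))\<^sup>2) (at x)"
    for P and h :: "real \<Rightarrow> complex" and a b
    by (rule DERIV_nonneg_imp_nondecreasing[of a b P]) (use that zero_le_power2 in blast)+
  define \<Phi> where "\<Phi> T = F T - F (- T)" for T
  define \<Gamma> where "\<Gamma> T = G T - G (- T)" for T
  \<comment> \<open>The summand 1 puts \<open>x0\<close> in the interior, so constancy of
    \<open>F\<close> on the open interval would force its derivative at \<open>x0\<close> to
    vanish.\<close>
  define a where "a = \<bar>x0\<bar> + 1"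
  have "\<Phi> a > 0"
  proof (rule ccontr)
    assume "\<not> \<Phi> a > 0"
    then have "F a \<le> F (- a)" by (simp add: \<Phi>_def)
    have const: "F x = F (- a)" if "x \<in> {- a<..<a}" for x
      using mono[OF F(1), of "- a" x] mono[OF F(1), of x a] that \<open>F a \<le> F (- a)\<close> by auto
    have "(F has_real_derivative 0) (at x0)"
      by (rule has_field_derivative_transform_within_open[of "\<lambda>_. F (- a)" _ _ "{- a<..<a}"])
        (auto simp: const, auto simp: a_def)
    then have "(cmod (f x0))\<^sup>2 = 0" using F(1) DERIV_unique by blast
    then show False using assms(3) by simp
  qed
  have approx: "\<exists>T\<ge>a. cmod (of_real (\<Gamma> T) - \<nu> * of_real (\<Phi> T)) \<le> e" if "e > 0" for e
  proof -
    obtain T where T: "T \<ge> max a (1 / e)" "T \<ge> 1"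
      "T * (((cmod (f T))\<^sup>2 + (cmod (g T))\<^sup>2) + ((cmod (f (- T)))\<^sup>2 + (cmod (g (- T)))\<^sup>2)) \<le> 1"
      using bounded_primitive_small[OF bounded_primitive_add[OF assms(1,2)]] by blast
    let ?s = "((cmod (f T))\<^sup>2 + (cmod (g T))\<^sup>2) + ((cmod (f (- T)))\<^sup>2 + (cmod (g (- T)))\<^sup>2)"
    have prod: "cmod (g x * cnj (f x)) \<le> (cmod (f x))\<^sup>2 + (cmod (g x))\<^sup>2" for x
    proof -
      have "2 * (cmod (g x) * cmod (f x)) \<le> (cmod (f x))\<^sup>2 + (cmod (g x))\<^sup>2"
        using sum_squares_bound[of "cmod (g x)" "cmod (f x)"] by simp
      moreover have "0 \<le> cmod (g x) * cmod (f x)" by simp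
      ultimately have "cmod (g x) * cmod (f x) \<le> (cmod (f x))\<^sup>2 + (cmod (g x))\<^sup>2"
        by linarith
      then show ?thesis by (simp add: norm_mult)
    qed
    have "of_real (\<Gamma> T) - \<nu> * of_real (\<Phi> T) = g T * cnj (f T) - g (- T) * cnj (f (- T))"
      by (simp add: c \<Gamma>_def \<Phi>_def algebra_simps)
    also have "cmod \<dots> \<le> ?s"
      using norm_triangle_ineq4[of "g T * cnj (f T)" "g (- T) * cnj (f (- T))"] prod[of T] prod[of "- T"]
      by linarith
    also have "?s \<le> 1 / T" using T by (simp add: field_simps)
    also have "\<dots> \<le> e" using T \<open>e > 0\<close> by (simp add: field_simps)
    finally show ?thesis using T by auto
  qed
  have big: "\<Phi> T \<ge> \<Phi> a" "\<Gamma> T \<ge> 0" if "T \<ge> a" for T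
    using mono[OF F(1), of a T] mono[OF F(1), of "- T" "- a"] mono[OF G, of "- T" T] that
    by (auto simp: \<Phi>_def \<Gamma>_def a_def)
  have "Im \<nu> = 0"
  proof (rule ccontr)
    assume "Im \<nu> \<noteq> 0"
    \<comment> \<open>The full product is a lower bound for the modulus for all
      \<open>T \<ge> a\<close>; asking for half of it produces the contradiction.\<close>
    then have "\<bar>Im \<nu>\<bar> * \<Phi> a / 2 > 0" using \<open>\<Phi> a > 0\<close> by simp
    then obtain T where T: "T \<ge> a" "cmod (of_real (\<Gamma> T) - \<nu> * of_real (\<Phi> T)) \<le> \<bar>Im \<nu>\<bar> * \<Phi> a / 2"
      using approx by blast
    have "\<bar>Im \<nu>\<bar> * \<Phi> a \<le> \<bar>Im \<nu>\<bar> * \<Phi> T" using big(1)[OF T(1)] by (intro mult_left_mono) auto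
    also have "\<dots> = \<bar>Im (of_real (\<Gamma> T) - \<nu> * of_real (\<Phi> T))\<bar>"
      using big(1)[OF T(1)] \<open>\<Phi> a > 0\<close> by (simp add: abs_mult)
    also have "\<dots> \<le> \<bar>Im \<nu>\<bar> * \<Phi> a / 2" using T(2) abs_Im_le_cmod order_trans by blast
    finally show False using \<open>Im \<nu> \<noteq> 0\<close> \<open>\<Phi> a > 0\<close> by simp
  qed
  moreover have "Re \<nu> \<ge> 0"
  proof (rule ccontr)
    assume neg: "\<not> Re \<nu> \<ge> 0"
    then have "- Re \<nu> * \<Phi> a / 2 > 0" using \<open>\<Phi> a > 0\<close> by (simp add: mult_neg_pos)
    then obtain T where T: "T \<ge> a" "cmod (of_real (\<Gamma> T) - \<nu> * of_real (\<Phi> T)) \<le> - Re \<nu> * \<Phi> a / 2"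
      using approx by blast
    have "- Re \<nu> * \<Phi> a \<le> - Re \<nu> * \<Phi> T" using big(1)[OF T(1)] neg by (intro mult_left_mono) auto
    also have "\<dots> \<le> Re (of_real (\<Gamma> T) - \<nu> * of_real (\<Phi> T))"
      using big(2)[OF T(1)] by simp
    also have "\<dots> \<le> - Re \<nu> * \<Phi> a / 2" using T(2) complex_Re_le_cmod order_trans by blast
    finally show False using neg \<open>\<Phi> a > 0\<close> by (simp add: mult_less_0_iff)
  qed
  ultimately show ?thesis by simp
qed

text \<open>The new function is \<open>A g\<close>, with the derivative of \<open>g\<close>
  eliminated. Since \<open>A A* g = \<nu> g\<close>, the commutator gives
  \<open>A* A g = (\<nu> - 2) g\<close>.\<close>

lemma ladder_next: "ladder g (\<lambda>x. 2 * of_real x * g x - \<nu> * f x) (\<nu> - 2)"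
proof
  fix x
  show "(g has_vector_derivative 2 * of_real x * g x - \<nu> * f x - of_real x * g x) (at x)"
    using g_deriv[of x] by simp
  have of_real: "(of_real has_vector_derivative (1::complex)) (at x)"
    using has_vector_derivative_of_real[OF DERIV_ident] by simp
  have "((\<lambda>x. 2 * (of_real x * g x) - \<nu> * f x) has_vector_derivative
      2 * (of_real x * (of_real x * g x - \<nu> * f x) + 1 * g x) - \<nu> * (g x - of_real x * f x)) (at x)"
    by (intro has_vector_derivative_diff has_vector_derivative_mult_right has_vector_derivative_mult
        f_deriv g_deriv of_real)
  moreover have "2 * (of_real x * (of_real x * g x - \<nu> * f x) + 1 * g x) - \<nu> * (g x - of_real x * f x) =
      of_real x * (2 * of_real x * g x - \<nu> * f x) - (\<nu> - 2) * g x"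
    by (simp add: algebra_simps)
  ultimately show "((\<lambda>x. 2 * of_real x * g x - \<nu> * f x) has_vector_derivative
      of_real x * (2 * of_real x * g x - \<nu> * f x) - (\<nu> - 2) * g x) (at x)"
    by (simp add: mult.assoc)
qed

text \<open>For real \<open>\<nu>\<close> and \<open>h = g' + x g\<close>, a primitive of \<open>|h|\<^sup>2\<close> is \<open>2 x |g|\<^sup>2\<close> plus a bounded function, and
  \<open>2 x |g|\<^sup>2\<close> is small along suitable \<open>x \<rightarrow> \<plusminus>\<infinity>\<close>.\<close>

lemma bounded_primitive_next:
  assumes bp: "bounded_primitive (\<lambda>x. (cmod (f x))\<^sup>2)" "bounded_primitive (\<lambda>x. (cmod (g x))\<^sup>2)"
    and "Im \<nu> = 0"
  shows "bounded_primitive (\<lambda>x. (cmod (2 * of_real x * g x - \<nu> * f x))\<^sup>2)"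
proof -
  define r where "r = Re \<nu>"
  have \<nu>: "\<nu> = of_real r" using assms(3) by (simp add: r_def complex_eq_iff)
  define h where "h x = 2 * of_real x * g x - \<nu> * f x" for x
  interpret nxt: ladder g h "\<nu> - 2" unfolding h_def by (rule ladder_next)
  obtain F A where F: "\<And>x. (F has_real_derivative (cmod (f x))\<^sup>2) (at x)" "\<And>x. \<bar>F x\<bar> \<le> A"
    using bp(1) by (rule bounded_primitiveE) blast
  obtain G B where G: "\<And>x. (G has_real_derivative (cmod (g x))\<^sup>2) (at x)" "\<And>x. \<bar>G x\<bar> \<le> B"
    using bp(2) by (rule bounded_primitiveE) blast
  obtain c where c: "\<And>x. g x * cnj (f x) = of_real (G x) - \<nu> * of_real (F x) + c"
    using pairing_eq[OF F(1) G(1)] by blast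
  \<comment> \<open>The pairing identity of the next rung, solved for the squared modulus of
    \<open>h\<close> and integrated; \<open>r\<close> stands for the real \<nu>.\<close>
  define H where "H = (\<lambda>x. Re (h x * cnj (g x)) + (r - 2) * G x)"
  have H: "(H has_real_derivative (cmod (h x))\<^sup>2) (at x)" for x
  proof -
    have "((\<lambda>x. Re (h x * cnj (g x)) + (r - 2) * G x) has_vector_derivative
        Re (of_real ((cmod (h x))\<^sup>2) - (\<nu> - 2) * of_real ((cmod (g x))\<^sup>2)) + (r - 2) * (cmod (g x))\<^sup>2) (at x)"
      by (intro has_vector_derivative_add has_vector_derivative_mult_right
          bounded_linear.has_vector_derivative[OF bounded_linear_Re] nxt.pairing_deriv
          G(1)[unfolded has_real_derivative_iff_has_vector_derivative])
    then show ?thesis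
      unfolding H_def has_real_derivative_iff_has_vector_derivative by (simp add: \<nu>)
  qed
  have mono: "H a \<le> H b" if "a \<le> b" for a b
    by (rule DERIV_nonneg_imp_nondecreasing[OF that]) (use H zero_le_power2 in blast)
  define C where "C = B + \<bar>r\<bar> * A + cmod c"
  have C: "\<bar>Re (f x * cnj (g x))\<bar> \<le> C" for x
  proof -
    have "\<bar>Re (f x * cnj (g x))\<bar> = \<bar>Re (g x * cnj (f x))\<bar>" by (simp add: mult.commute)
    also have "\<dots> \<le> cmod (of_real (G x) - \<nu> * of_real (F x) + c)"
      unfolding c[symmetric] by (rule abs_Re_le_cmod)
    also have "\<dots> \<le> cmod (of_real (G x) :: complex) + cmod (\<nu> * of_real (F x)) + cmod c"
      by (meson add_right_mono norm_triangle_ineq norm_triangle_ineq4 order_trans)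
    also have "\<dots> \<le> B + \<bar>r\<bar> * A + cmod c"
      using F(2)[of x] G(2)[of x] by (intro add_mono) (auto simp: norm_mult \<nu> intro: mult_left_mono)
    finally show ?thesis by (simp add: C_def)
  qed
  define D where "D = \<bar>r\<bar> * C + \<bar>r - 2\<bar> * B"
  have HD: "\<bar>H x - 2 * x * (cmod (g x))\<^sup>2\<bar> \<le> D" for x
  proof -
    have Re_mult: "Re (of_real r * z) = r * Re z" for z by simp
    have "h x * cnj (g x) = of_real (2 * x * (cmod (g x))\<^sup>2) - of_real r * (f x * cnj (g x))"
      by (simp add: h_def \<nu> complex_norm_square[symmetric] left_diff_distrib mult.assoc)
    then have "Re (h x * cnj (g x)) = 2 * x * (cmod (g x))\<^sup>2 - r * Re (f x * cnj (g x))"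
      by (simp only: minus_complex.sel Re_complex_of_real Re_mult)
    then have "H x - 2 * x * (cmod (g x))\<^sup>2 = (r - 2) * G x - r * Re (f x * cnj (g x))"
      unfolding H_def by linarith
    also have "\<bar>\<dots>\<bar> \<le> \<bar>r - 2\<bar> * \<bar>G x\<bar> + \<bar>r\<bar> * \<bar>Re (f x * cnj (g x))\<bar>"
      by (metis abs_mult abs_triangle_ineq4)
    also have "\<dots> \<le> \<bar>r - 2\<bar> * B + \<bar>r\<bar> * C"
      using C[of x] G(2)[of x] by (intro add_mono mult_left_mono) auto
    finally show ?thesis by (simp add: D_def)
  qed
  \<comment> \<open>Control is available only at special \<open>T\<close>, but \<open>H\<close> is
    monotone, so its oscillation over \<open>{- T..T}\<close> bounds \<open>H x - H 0\<close> for
    every \<open>x\<close> inside.\<close>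
  have "\<bar>H x - H 0\<bar> \<le> 2 + 2 * D" for x
  proof -
    obtain T where T: "T \<ge> \<bar>x\<bar>" "T * ((cmod (g T))\<^sup>2 + (cmod (g (- T)))\<^sup>2) \<le> 1"
      using bounded_primitive_small[OF bp(2)] by blast
    have "H T - H (- T) \<le> 2 * (T * ((cmod (g T))\<^sup>2 + (cmod (g (- T)))\<^sup>2)) + 2 * D"
      using HD[of T] HD[of "- T"] by (simp add: algebra_simps abs_le_iff)
    then have "H T - H (- T) \<le> 2 + 2 * D" using T(2) by simp
    moreover have "- T \<le> x" "x \<le> T" "0 \<le> T" "- T \<le> 0" using T(1) by auto
    then have "H (- T) \<le> H x" "H x \<le> H T" "H 0 \<le> H T" "H (- T) \<le> H 0"
      by (simp_all only: mono)
    ultimately show ?thesis by linarith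
  qed
  then have "\<bar>H x - H 0\<bar> \<le> 2 + 2 * D" for x .
  moreover have "((\<lambda>x. H x - H 0) has_real_derivative (cmod (h x))\<^sup>2) (at x)" for x
    using DERIV_diff[OF H DERIV_const] by simp
  ultimately show ?thesis
    unfolding bounded_primitive_def h_def by blast
qed

end

text \<open>Integrating factor. The values \<open>a = - 1\<close> and \<open>a = 1\<close> describe
  the kernels of \<open>A\<close> and of \<open>A*\<close>.\<close>

lemma gaussian_solution:
  fixes f :: "real \<Rightarrow> complex"
  assumes "\<And>x. (f has_vector_derivative of_real (a * x) * f x) (at x)"
  shows "f x = f 0 * of_real (exp (a * x\<^sup>2 / 2))"
proof -
  have "((\<lambda>x. of_real (exp (- a * x\<^sup>2 / 2)) * f x) has_vector_derivative 0) (at x)" for x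
  proof -
    have "((\<lambda>x. exp (- a * x\<^sup>2 / 2)) has_real_derivative - a * x * exp (- a * x\<^sup>2 / 2)) (at x)"
      by (auto intro!: derivative_eq_intros)
    then have "((\<lambda>x. of_real (exp (- a * x\<^sup>2 / 2)) * f x) has_vector_derivative
        of_real (exp (- a * x\<^sup>2 / 2)) * (of_real (a * x) * f x)
        + of_real (- a * x * exp (- a * x\<^sup>2 / 2)) * f x) (at x)"
      by (intro has_vector_derivative_mult has_vector_derivative_of_real assms)
    then show ?thesis by (simp add: algebra_simps)
  qed
  from zero_vector_derivative_imp_constant[OF this, of 0 x]
  have "f 0 = of_real (exp (- a * x\<^sup>2 / 2)) * f x" by simp
  then have "f 0 * of_real (exp (a * x\<^sup>2 / 2)) = of_real (exp (- a * x\<^sup>2 / 2) * exp (a * x\<^sup>2 / 2)) * f x"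
    by (simp add: mult_ac)
  also have "exp (- a * x\<^sup>2 / 2) * exp (a * x\<^sup>2 / 2) = 1"
    by (simp add: exp_add[symmetric])
  finally show ?thesis by simp
qed

text \<open>Induction on a bound \<open>2 * real N\<close> for the real part of \<nu>, which each
  rung lowers by 2; at \<open>N = 0\<close> nonnegativity of \<nu> is violated. If \<open>g\<close>
  vanishes, \<open>f\<close> is in the kernel of \<open>A\<close>; otherwise \<open>g\<close> is a
  Hermite function by induction and \<open>f\<close> is recovered as \<open>A* g\<close> divided by
  \<nu>.\<close>

lemma ladder_classification:
  assumes "ladder f g \<nu>"
    and "bounded_primitive (\<lambda>x. (cmod (f x))\<^sup>2)" "bounded_primitive (\<lambda>x. (cmod (g x))\<^sup>2)"
    and "f x0 \<noteq> 0"
  shows "\<exists>n c. \<nu> = of_nat (2 * n) \<and> (\<forall>x. f x = c * of_real (hermite_phi n x))"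
proof -
  obtain N :: nat where "Re \<nu> < 2 * real N"
    using reals_Archimedean2[of "Re \<nu> / 2"] by (auto simp: mult.commute)
  then show ?thesis
    using assms
  proof (induction N arbitrary: f g \<nu> x0)
    case 0
    interpret ladder f g \<nu> by (rule 0)
    show ?case using eigenvalue_nonneg[OF 0(3,4,5)] 0(1) by simp
  next
    case (Suc N)
    interpret ladder f g \<nu> by (rule Suc)
    note bp = Suc.prems(3,4)
    note ev = eigenvalue_nonneg[OF bp Suc.prems(5)]
    show ?case
    proof (cases "\<exists>x1. g x1 \<noteq> 0")
      case False
      then have g0: "g x = 0" for x by blast
      have "(g has_vector_derivative 0) (at x0)"
        using g0 by (simp add: ext[of g "\<lambda>_. 0"])
      then have "of_real x0 * g x0 - \<nu> * f x0 = 0"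
        using g_deriv[of x0] vector_derivative_unique_at by blast
      then have "\<nu> = 0" using Suc.prems(5) g0 by simp
      moreover have "f x = (f 0 / of_real (hermite_C 0)) * of_real (hermite_phi 0 x)" for x
      proof -
        have "f x = f 0 * of_real (exp (- 1 * x\<^sup>2 / 2))"
          by (rule gaussian_solution) (use f_deriv g0 in simp)
        moreover have "f 0 * of_real (exp (- 1 * x\<^sup>2 / 2)) =
            (f 0 / of_real (hermite_C 0)) * of_real (hermite_phi 0 x)"
          using hermite_C_pos[of 0] by (simp add: hermite_phi_0)
        ultimately show ?thesis by (rule trans)
      qed
      ultimately show ?thesis by (metis mult_0_right of_nat_0)
    next
      case True
      then obtain x1 where x1: "g x1 \<noteq> 0" by blast
      have "\<exists>n c. \<nu> - 2 = of_nat (2 * n) \<and> (\<forall>x. g x = c * of_real (hermite_phi n x))"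
        using Suc.prems(1) ev
        by (intro Suc.IH[OF _ ladder_next bp(2) bounded_primitive_next[OF bp] x1]) auto
      then obtain n c where n: "\<nu> - 2 = of_nat (2 * n)" and g: "\<And>x. g x = c * of_real (hermite_phi n x)"
        by blast
      have \<nu>: "\<nu> = of_nat (2 * Suc n)" using n by (simp add: algebra_simps)
      \<comment> \<open>Read off from \<open>\<nu> f = A* g\<close>, where raising \<open>g\<close>
        contributes the square root.\<close>
      define d where "d = c * of_real (sqrt (2 * real (Suc n))) / \<nu>"
      have "f x = d * of_real (hermite_phi (Suc n) x)" for x
      proof -
        have "((\<lambda>x. c * of_real (hermite_phi n x)) has_vector_derivative
          c * of_real (x * hermite_phi n x - sqrt (2 * real (Suc n)) * hermite_phi (Suc n) x)) (at x)"
          by (intro has_vector_derivative_mult_right has_vector_derivative_of_real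
              hermite_phi_raise)
        moreover have "(\<lambda>x. c * of_real (hermite_phi n x)) = g" using g by auto
        ultimately have "of_real x * g x - \<nu> * f x =
            c * of_real (x * hermite_phi n x - sqrt (2 * real (Suc n)) * hermite_phi (Suc n) x)"
          using g_deriv[of x] vector_derivative_unique_at by auto
        then have "\<nu> * f x = c * of_real (sqrt (2 * real (Suc n))) * of_real (hermite_phi (Suc n) x)"
          unfolding g of_real_diff of_real_mult by (simp add: algebra_simps del: of_nat_Suc)
        moreover have "\<nu> \<noteq> 0" unfolding \<nu> by (simp del: of_nat_Suc)
        ultimately show ?thesis by (simp add: d_def field_simps)
      qed
      with \<nu> show ?thesis by blast
    qed
  qed
qed

section \<open>Eigenfunctions of the Dirac operator\<close>

lemma bounded_primitive_cmult:
  assumes "bounded_primitive w"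
  shows "bounded_primitive (\<lambda>x. a * w x)"
proof -
  obtain F B where F: "\<And>x. (F has_real_derivative w x) (at x)" "\<And>x. \<bar>F x\<bar> \<le> B"
    using assms by (rule bounded_primitiveE) blast
  have "((\<lambda>x. a * F x) has_real_derivative a * w x) (at x)" for x
    using F(1) by (rule DERIV_cmult)
  moreover have "\<bar>a * F x\<bar> \<le> \<bar>a\<bar> * B" for x
    using F(2) by (simp add: abs_mult mult_left_mono)
  ultimately show ?thesis unfolding bounded_primitive_def by blast
qed

text \<open>Continuity supplies a primitive; as the integrand is nonnegative, each increment of the
  primitive is at most the integral over the whole line.\<close>

lemma square_integrable_imp_bounded_primitive:
  assumes sq: "square_integrable f" and cont: "continuous_on UNIV f"
  shows "bounded_primitive (\<lambda>x. (cmod (f x))\<^sup>2)"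
proof -
  define w where "w = (\<lambda>x. (cmod (f x))\<^sup>2)"
  have "isCont w x" for x
    using cont unfolding w_def by (intro continuous_intros) (simp add: continuous_on_eq_continuous_at)
  then obtain F where F: "\<And>x. (F has_vector_derivative w x) (at x)"
    using einterval_antiderivative[of "- \<infinity>" \<infinity> w] by auto
  have "set_integrable lebesgue UNIV w"
    using sq by (simp add: square_integrable_def set_integrable_def w_def)
  then have int: "w integrable_on UNIV"
    by (rule set_lebesgue_integral_eq_integral(1))
  have FTC: "0 \<le> F b - F a \<and> F b - F a \<le> integral UNIV w" if "a \<le> b" for a b
  proof -
    have "(w has_integral F b - F a) {a..b}"
      using that F by (intro fundamental_theorem_of_calculus) (auto intro: has_vector_derivative_at_within)
    then have "integral {a..b} w = F b - F a" "w integrable_on {a..b}"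
      by (auto simp: has_integral_iff)
    moreover have "0 \<le> integral {a..b} w"
      using calculation(2) by (rule integral_nonneg) (simp add: w_def)
    moreover have "integral {a..b} w \<le> integral UNIV w"
      using calculation(2) int by (intro integral_subset_le) (auto simp: w_def)
    ultimately show ?thesis by simp
  qed
  have "\<bar>F x - F 0\<bar> \<le> integral UNIV w" for x
    using FTC[of 0 x] FTC[of x 0] by (cases "x \<ge> 0") auto
  moreover have "((\<lambda>x. F x - F 0) has_real_derivative w x) (at x)" for x
    using DERIV_diff[OF F[unfolded has_real_derivative_iff_has_vector_derivative[symmetric]] DERIV_const]
    by simp
  ultimately show ?thesis
    unfolding bounded_primitive_def w_def by blast
qed

lemma square_integrable_cmult:
  assumes "square_integrable f"
  shows "square_integrable (\<lambda>x. a * f x)"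
  using assms by (auto simp: square_integrable_def norm_mult power_mult_distrib)

section \<open>Verification and exhaustion of the eigenfunctions\<close>

text \<open>Classical solutions are continuously differentiable, hence locally Lipschitz and
  absolutely continuous. The domain condition on \<open>dirac_expr\<close> follows from the one on
  \<open>y\<close>, of which it is a multiple.\<close>

lemma dirac_eigenfunctionI:
  assumes ode: "\<And>x. ((\<lambda>x. y x $ 1) has_vector_derivative of_real x * y x $ 1 - \<mu> * y x $ 2) (at x)"
      "\<And>x. ((\<lambda>x. y x $ 2) has_vector_derivative \<mu> * y x $ 1 - of_real x * y x $ 2) (at x)"
    and sq: "square_integrable (\<lambda>x. y x $ 1)" "square_integrable (\<lambda>x. y x $ 2)"
    and "y \<noteq> (\<lambda>x. 0)"
  shows "dirac_eigenfunction \<mu> y"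
proof -
  have cont: "continuous_on UNIV (\<lambda>x. y x $ 1)" "continuous_on UNIV (\<lambda>x. y x $ 2)"
    using ode by (auto intro!: continuous_at_imp_continuous_on intro: has_vector_derivative_continuous)
  have "absolutely_continuous_on {a..b} (\<lambda>x. y x $ 1)" for a b
    by (rule absolutely_continuous_on_C1[OF ode(1)]) (intro continuous_intros cont)
  moreover have "absolutely_continuous_on {a..b} (\<lambda>x. y x $ 2)" for a b
    by (rule absolutely_continuous_on_C1[OF ode(2)]) (intro continuous_intros cont)
  moreover have expr: "dirac_expr y x = \<mu> *s y x" for x
  proof -
    have "(y has_vector_derivative vector [of_real x * y x $ 1 - \<mu> * y x $ 2, \<mu> * y x $ 1 - of_real x * y x $ 2]) (at x)"
      using ode by (simp add: has_vector_derivative_vec2)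
    then have "vector_derivative y (at x) = vector [of_real x * y x $ 1 - \<mu> * y x $ 2, \<mu> * y x $ 1 - of_real x * y x $ 2]"
      by (rule vector_derivative_at)
    then show ?thesis by (simp add: vec2_eq_iff dirac_expr_nth)
  qed
  ultimately show ?thesis
    using sq \<open>y \<noteq> (\<lambda>x. 0)\<close>
    by (simp add: dirac_eigenfunction_def dirac_domain_def forall_2 square_integrable_cmult)
qed

lemma dirac_U_nth:
  "dirac_U 0 x $ 1 = 0" "dirac_U 0 x $ 2 = of_real (hermite_phi 0 x)"
  "dirac_U (int (Suc m)) x $ 1 = of_real (hermite_phi m x)"
  "dirac_U (int (Suc m)) x $ 2 = of_real (hermite_phi (Suc m) x)"
  "dirac_U (- int (Suc m)) x $ 1 = - of_real (hermite_phi m x)"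
  "dirac_U (- int (Suc m)) x $ 2 = of_real (hermite_phi (Suc m) x)"
  by (simp_all add: dirac_U_def nat_add_distrib)

lemma dirac_lambda_simps:
  "dirac_lambda 0 = 0"
  "dirac_lambda (int (Suc m)) = sqrt (2 * real (Suc m))"
  "dirac_lambda (- int (Suc m)) = - sqrt (2 * real (Suc m))"
  by (simp_all add: dirac_lambda_def)

lemma int_sign_cases:
  obtains "n = 0" | m where "n = int (Suc m)" | m where "n = - int (Suc m)"
proof (cases n)
  case (nonneg k)
  then show ?thesis using that(1,2) by (cases k) auto
next
  case (neg k)
  then show ?thesis using that(3) by blast
qed

lemma dirac_eigenfunction_dirac_U:
  assumes "c \<noteq> 0"
  shows "dirac_eigenfunction (of_real (dirac_lambda n)) (\<lambda>x. c *s dirac_U n x)"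
proof -
  have cphi: "((\<lambda>x. c * of_real (hermite_phi k x)) has_vector_derivative c * of_real d) (at x)"
    if "(hermite_phi k has_real_derivative d) (at x)" for k d x and c :: complex
    using that by (intro has_vector_derivative_mult_right has_vector_derivative_of_real)
  have nz: "\<exists>x. hermite_phi k x \<noteq> 0" for k
    using hermite_phi_nonzero[of k] by auto
  note sq = square_integrable_hermite_phi
  have sq0: "square_integrable (\<lambda>x. 0)"
    by (simp add: square_integrable_def)
  show ?thesis
  proof (cases n rule: int_sign_cases)
    case 1
    show ?thesis
    proof (rule dirac_eigenfunctionI)
      show "(\<lambda>x. c *s dirac_U n x) \<noteq> (\<lambda>x. 0)"
        using nz[of 0] assms by (auto simp: fun_eq_iff vec2_eq_iff dirac_U_nth 1)
    qed (use cphi[OF hermite_phi_lower_0, of c] in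
        \<open>simp_all add: dirac_U_nth dirac_lambda_simps 1 sq sq0 mult_ac\<close>)
  next
    case (2 m)
    show ?thesis
      unfolding 2
    proof (rule dirac_eigenfunctionI)
      show "(\<lambda>x. c *s dirac_U (int (Suc m)) x) \<noteq> (\<lambda>x. 0)"
        using nz[of m] assms by (auto simp: fun_eq_iff vec2_eq_iff dirac_U_nth simp del: of_nat_Suc)
    qed (use cphi[OF hermite_phi_lower, of c m] cphi[OF hermite_phi_raise, of c m] in
        \<open>simp_all add: dirac_U_nth dirac_lambda_simps sq algebra_simps del: of_nat_Suc\<close>)
  next
    case (3 m)
    show ?thesis
      unfolding 3
    proof (rule dirac_eigenfunctionI)
      show "(\<lambda>x. c *s dirac_U (- int (Suc m)) x) \<noteq> (\<lambda>x. 0)"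
        using nz[of m] assms by (auto simp: fun_eq_iff vec2_eq_iff dirac_U_nth simp del: of_nat_Suc)
    qed (use cphi[OF hermite_phi_lower, of c m] cphi[OF hermite_phi_raise, of "- c" m] sq[of "- c" m] in
        \<open>simp_all add: dirac_U_nth dirac_lambda_simps sq algebra_simps del: of_nat_Suc\<close>)
  qed
qed

text \<open>The ladder determines the second component and the square of \<mu>. The sign of \<mu>
  and the first component are recovered from \<open>A v = \<mu> u\<close>, which requires division
  by \<mu>.\<close>

lemma dirac_eigenfunction_cases:
  assumes "dirac_eigenfunction \<mu> y"
  shows "\<exists>n c. \<mu> = of_real (dirac_lambda n) \<and> c \<noteq> 0 \<and> y = (\<lambda>x. c *s dirac_U n x)"
proof -
  define u where "u = (\<lambda>x. y x $ 1)"
  define v where "v = (\<lambda>x. y x $ 2)"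
  have du: "(u has_vector_derivative of_real x * u x - \<mu> * v x) (at x)" for x
    unfolding u_def v_def by (rule dirac_eigenfunction_imp_ode[OF assms])
  have dv: "(v has_vector_derivative \<mu> * u x - of_real x * v x) (at x)" for x
    unfolding u_def v_def by (rule dirac_eigenfunction_imp_ode[OF assms])
  have cont: "continuous_on UNIV u" "continuous_on UNIV v"
    using du dv by (auto intro!: continuous_at_imp_continuous_on intro: has_vector_derivative_continuous)
  have "square_integrable u" "square_integrable v"
    using assms by (simp_all add: dirac_eigenfunction_def dirac_domain_def u_def v_def)
  then have bp: "bounded_primitive (\<lambda>x. (cmod (u x))\<^sup>2)" "bounded_primitive (\<lambda>x. (cmod (v x))\<^sup>2)"
    using cont by (auto intro: square_integrable_imp_bounded_primitive)
  have nonzero: "\<not> (\<forall>x. u x = 0 \<and> v x = 0)"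
    using assms by (auto simp: dirac_eigenfunction_def fun_eq_iff vec2_eq_iff u_def v_def)
  show ?thesis
  proof (cases "\<mu> = 0")
    case True
    have u: "u x = u 0 * of_real (exp (1 * x\<^sup>2 / 2))" for x
      by (rule gaussian_solution) (use du True in simp)
    have v: "v x = v 0 * of_real (exp (- 1 * x\<^sup>2 / 2))" for x
      by (rule gaussian_solution) (use dv True in simp)
    \<comment> \<open>Otherwise the squared modulus of \<open>u\<close> is at least
      \<open>a > 0\<close> everywhere, and its values at \<open>T\<close> and \<open>- T\<close>,
      summed and multiplied by some \<open>T \<ge> 1 / a\<close>, give at least 2 instead of at most
      1.\<close>
    have "u 0 = 0"
    proof (rule ccontr)
      assume "u 0 \<noteq> 0"
      define a where "a = (cmod (u 0))\<^sup>2"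
      have "a > 0" using \<open>u 0 \<noteq> 0\<close> by (simp add: a_def)
      have "a \<le> (cmod (u x))\<^sup>2" for x
      proof -
        have "cmod (u 0) * 1 \<le> cmod (u 0) * exp (1 * x\<^sup>2 / 2)"
          by (intro mult_left_mono) auto
        also have "\<dots> = cmod (u x)"
          by (subst (2) u) (simp add: norm_mult)
        finally show ?thesis by (simp add: a_def)
      qed
      moreover obtain T where T: "T \<ge> 1 / a" "T \<ge> 1" "T * ((cmod (u T))\<^sup>2 + (cmod (u (- T)))\<^sup>2) \<le> 1"
        using bounded_primitive_small[OF bp(1)] by blast
      ultimately have "T * (a + a) \<le> 1"
        by (smt (verit) mult_left_mono)
      moreover have "1 \<le> T * a" using T(1) \<open>a > 0\<close> by (simp add: field_simps)
      ultimately show False by (simp add: algebra_simps)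
    qed
    then have u0: "u x = 0" for x using u[of x] by simp
    define c where "c = v 0 / of_real (hermite_C 0)"
    have vc: "v x = c * of_real (hermite_phi 0 x)" for x
      using hermite_C_pos[of 0] by (subst v) (simp add: c_def hermite_phi_0)
    have "c \<noteq> 0" using nonzero u0 vc by auto
    moreover have "y = (\<lambda>x. c *s dirac_U 0 x)"
      using u0 vc by (auto simp: fun_eq_iff vec2_eq_iff dirac_U_nth u_def v_def)
    ultimately show ?thesis using True by (intro exI[of _ 0] exI[of _ c]) (simp add: dirac_lambda_simps)
  next
    case False
    have lad: "ladder v (\<lambda>x. \<mu> * u x) (\<mu>\<^sup>2)"
    proof
      fix x
      show "(v has_vector_derivative \<mu> * u x - of_real x * v x) (at x)" by (rule dv)
      have "((\<lambda>x. \<mu> * u x) has_vector_derivative \<mu> * (of_real x * u x - \<mu> * v x)) (at x)"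
        by (intro has_vector_derivative_mult_right du)
      then show "((\<lambda>x. \<mu> * u x) has_vector_derivative of_real x * (\<mu> * u x) - \<mu>\<^sup>2 * v x) (at x)"
        by (simp add: algebra_simps power2_eq_square)
    qed
    \<comment> \<open>If \<open>v\<close> vanished, so would \<open>\<mu> * u x\<close>, and with
      nonzero \<mu> the whole eigenfunction.\<close>
    have "\<exists>x0. v x0 \<noteq> 0"
    proof (rule ccontr)
      assume "\<nexists>x0. v x0 \<noteq> 0"
      then have v0: "v = (\<lambda>x. 0)" by auto
      have "\<mu> * u x = 0" for x
        using vector_derivative_unique_at[OF dv[of x, unfolded v0] has_vector_derivative_const] by simp
      then show False using nonzero False v0 by simp
    qed
    then obtain x0 where x0: "v x0 \<noteq> 0" by blast
    have "bounded_primitive (\<lambda>x. (cmod (\<mu> * u x))\<^sup>2)"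
      using bounded_primitive_cmult[OF bp(1), of "(cmod \<mu>)\<^sup>2"] by (simp add: norm_mult power_mult_distrib)
    then obtain n c where n: "\<mu>\<^sup>2 = of_nat (2 * n)" and vc: "\<And>x. v x = c * of_real (hermite_phi n x)"
      using ladder_classification[OF lad bp(2) _ x0] by blast
    have "n \<noteq> 0" using n False by (intro notI) simp
    then obtain m where m: "n = Suc m" by (cases n) auto
    define s where "s = sqrt (2 * real (Suc m))"
    have "s > 0" by (simp add: s_def)
    have "c \<noteq> 0" using x0 vc by auto
    have mu: "\<mu> * u x = c * of_real (s * hermite_phi m x)" for x
    proof -
      have "(v has_vector_derivative c * of_real (s * hermite_phi m x - x * hermite_phi (Suc m) x)) (at x)"
        unfolding ext[of v, OF vc] m s_def
        by (intro has_vector_derivative_mult_right has_vector_derivative_of_real hermite_phi_lower)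
      then have "\<mu> * u x - of_real x * v x = c * of_real (s * hermite_phi m x - x * hermite_phi (Suc m) x)"
        using dv vector_derivative_unique_at by blast
      then show ?thesis by (simp add: vc m algebra_simps)
    qed
    have "\<mu>\<^sup>2 = (of_real s)\<^sup>2"
      unfolding n m of_real_power[symmetric] by (simp add: s_def)
    then consider "\<mu> = of_real s" | "\<mu> = - of_real s" by (auto simp: power2_eq_iff)
    then show ?thesis
    proof cases
      case 1
      have "u x = c * of_real (hermite_phi m x)" for x
        using mu[of x] \<open>s > 0\<close> by (simp add: 1)
      then have "y = (\<lambda>x. c *s dirac_U (int (Suc m)) x)"
        using vc by (simp add: fun_eq_iff vec2_eq_iff dirac_U_nth u_def v_def m del: of_nat_Suc)
      moreover have "\<mu> = of_real (dirac_lambda (int (Suc m)))"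
        by (simp only: dirac_lambda_simps 1 s_def)
      ultimately show ?thesis using \<open>c \<noteq> 0\<close> by blast
    next
      case 2
      have "u x = - c * of_real (hermite_phi m x)" for x
      proof -
        have "of_real s * (u x + c * of_real (hermite_phi m x)) = 0"
          using mu[of x] by (simp add: 2 algebra_simps) (metis add.right_inverse)
        then show ?thesis using \<open>s > 0\<close> by (simp add: eq_neg_iff_add_eq_0)
      qed
      then have "y = (\<lambda>x. c *s dirac_U (- int (Suc m)) x)"
        using vc by (simp add: fun_eq_iff vec2_eq_iff dirac_U_nth u_def v_def m del: of_nat_Suc)
      moreover have "\<mu> = of_real (dirac_lambda (- int (Suc m)))"
        by (simp only: dirac_lambda_simps 2 s_def of_real_minus)
      ultimately show ?thesis using \<open>c \<noteq> 0\<close> by blast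
    qed
  qed
qed

text \<open>Multiplying an eigenvalue by its absolute value keeps the sign and removes the root,
  which recovers the index.\<close>

lemma inj_dirac_lambda: "inj dirac_lambda"
proof (rule injI)
  have "dirac_lambda n * \<bar>dirac_lambda n\<bar> = 2 * of_int n" for n
    by (simp add: dirac_lambda_def abs_mult sgn_if)
  then show "m = n" if "dirac_lambda m = dirac_lambda n" for m n
    using that by (metis mult_cancel_left of_int_eq_iff zero_neq_numeral)
qed

theorem mainTheorem1:
  shows "{\<mu>. dirac_eigenvalue \<mu>} = range (\<lambda>n::int. complex_of_real (dirac_lambda n)) \<and>
    (\<forall>(n::int) y. dirac_eigenfunction (complex_of_real (dirac_lambda n)) y \<longleftrightarrow>
       (\<exists>c::complex. c \<noteq> 0 \<and> y = (\<lambda>x. c *s dirac_U n x)))"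
proof (intro conjI allI iffI)
  show "{\<mu>. dirac_eigenvalue \<mu>} = range (\<lambda>n::int. complex_of_real (dirac_lambda n))"
  proof (intro equalityI subsetI)
    fix \<mu> assume "\<mu> \<in> {\<mu>. dirac_eigenvalue \<mu>}"
    then obtain y where "dirac_eigenfunction \<mu> y" by (auto simp: dirac_eigenvalue_def)
    from dirac_eigenfunction_cases[OF this]
    show "\<mu> \<in> range (\<lambda>n::int. complex_of_real (dirac_lambda n))" by (elim exE conjE) simp
  next
    fix \<mu> assume "\<mu> \<in> range (\<lambda>n::int. complex_of_real (dirac_lambda n))"
    then obtain n where "\<mu> = of_real (dirac_lambda n)" by blast
    with dirac_eigenfunction_dirac_U[of 1 n] show "\<mu> \<in> {\<mu>. dirac_eigenvalue \<mu>}"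
      unfolding dirac_eigenvalue_def by (intro CollectI) (rule exI, simp)
  qed
  fix n y
  show "\<exists>c. c \<noteq> 0 \<and> y = (\<lambda>x. c *s dirac_U n x)" if ev: "dirac_eigenfunction (of_real (dirac_lambda n)) y"
  proof -
    obtain m c where mc: "complex_of_real (dirac_lambda n) = of_real (dirac_lambda m)"
      "c \<noteq> 0" "y = (\<lambda>x. c *s dirac_U m x)"
      using dirac_eigenfunction_cases[OF ev] by (elim exE conjE)
    \<comment> \<open>Distinct indices have distinct eigenvalues, so the index found by the
      classification is the given one and every eigenvalue is simple.\<close>
    have "m = n" using mc(1) inj_dirac_lambda by (simp add: inj_eq)
    with mc show ?thesis by (intro exI[of _ c]) simp
  qed
  show "dirac_eigenfunction (of_real (dirac_lambda n)) y" if "\<exists>c. c \<noteq> 0 \<and> y = (\<lambda>x. c *s dirac_U n x)"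
    using that by (elim exE conjE) (hypsubst, rule dirac_eigenfunction_dirac_U)
qed

end
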